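(* Let $m\ge 1$ be an integer and let $a,b,A,B,C,D$ be complex constants with $a\neq 0$, $A\ne 0$, $C\ne 0$. Put $\varphi(z)=Az+B$, $\psi(z)=Ce^{Dz}$, $\phi(z)=(aAz+aB+b)^m$, and let $\mathbb{S}_{\max}$ be the maximal multi-valued weighted composition operator on $\mathcal{F}^2$ induced by the equation $\psi\cdot f\circ\varphi=\phi\cdot g^{(m)}$. For every $z\in\mathbb{C}$ the following hold. (1) If $f\in\mathrm{dom}(\mathbb{S}_{\max})$, then $f$ has a zero at $-b/a$ of order at least $m$. (2) $K_{z,a,b}^{[k]}\notin\mathrm{dom}(\mathbb{S}_{\max})$ for every integer $k$ with $0\le k<m$. (3) $K_{z,a,b}^{[k]}\in\mathrm{dom}(\mathbb{S}_{\max})$ for every integer $k\ge m$, and moreover $\mathbb{S}_{\max}(K_{z,a,b}^{[k]})$ is precisely the set of entire functions $\vartheta_{z,a,b,k}$ satisfying $$\vartheta_{z,a,b,k}^{(m)}(x)=Ce^{B\overline{z}}(aAx+aB+b)^{k-m}K_{\overline{A}z+\overline{D}}(x),\qquad x\in\mathbb{C},$$ which is an $m$-dimensional affine set. In particular, for $k=m$, $$\vartheta_{z,a,b,m}(x)=\begin{cases}\dfrac{1}{m!}Ce^{B\overline{z}}x^m+\lambda(x),&\overline{A}z+\overline{D}=0,\\[2mm] Ce^{B\overline{z}}(A\overline{z}+D)^{-m}K_{\overline{A}z+\overline{D}}(x)+\lambda(x),&\overline{A}z+\overline{D}\neq0,\end{cases}$$ where $\lambda\in\mathbb{C}_{m-1}[z]$.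 (4) The closure of $\mathrm{dom}(\mathbb{S}_{\max})$ in $\mathcal{F}^2$ is $\mathcal{F}^2(m,-b/a)$.
   Context: Fock space $\mathcal{F}^2$ is the Hilbert space of entire functions $f$ with $\int_{\mathbb{C}}|f(z)|^2e^{-|z|^2}dV(z)<\infty$, with inner product $\langle f,g\rangle=\frac1\pi\int_{\mathbb{C}}f(z)\overline{g(z)}e^{-|z|^2}dV(z)$, where $dV$ is area measure. $\mathbb{S}_{\max}$ is the multi-valued linear operator with $\mathrm{dom}(\mathbb{S}_{\max})=\{f\in\mathcal{F}^2:\exists g\in\mathcal{F}^2,\ \psi\cdot f\circ\varphi=\phi\cdot g^{(m)}\}$ and $\mathbb{S}_{\max}(f)=\{g\in\mathcal{F}^2:\psi\cdot f\circ\varphi=\phi\cdot g^{(m)}\}$. Notation: $K_{z,a,b}^{[k]}(x)=(ax+b)^ke^{x\overline{z}}$; $K_w(x)=e^{x\overline{w}}$; $\mathbb{C}_{p}[z]$ is the set of polynomials of degree at most $p$; $\mathcal{F}^2(m,y)=\{f\in\mathcal{F}^2:f(y)=f'(y)=\cdots=f^{(m-1)}(y)=0\}$. "A zero at $y$ of order at least $m$" means $f^{(j)}(y)=0$ for $0\le j\le m-1$ (so the zero function qualifies). *)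

theory Defs
  imports "HOL-Complex_Analysis.Complex_Analysis" "HOL-Library.Function_Algebras"
begin

definition fock_space :: "(complex \<Rightarrow> complex) set" where
  "fock_space = {f. f holomorphic_on UNIV \<and>
     integrable lborel (\<lambda>z::complex. (norm (f z))\<^sup>2 * exp (- (norm z)\<^sup>2))}"

definition fock_inner :: "(complex \<Rightarrow> complex) \<Rightarrow> (complex \<Rightarrow> complex) \<Rightarrow> complex" where
  "fock_inner f g =
     1 / of_real pi * (\<integral>z. f z * cnj (g z) * of_real (exp (- (norm z)\<^sup>2)) \<partial>lborel)"

definition fock_norm :: "(complex \<Rightarrow> complex) \<Rightarrow> real" where
  "fock_norm f = sqrt (Re (fock_inner f f))"

definition fock_dist :: "(complex \<Rightarrow> complex) \<Rightarrow> (complex \<Rightarrow> complex) \<Rightarrow> real" where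
  "fock_dist f g = fock_norm (f - g)"

definition fock_topology :: "(complex \<Rightarrow> complex) topology" where
  "fock_topology = Metric_space.mtopology fock_space fock_dist"

definition fock_zeros :: "nat \<Rightarrow> complex \<Rightarrow> (complex \<Rightarrow> complex) set" where
  "fock_zeros m y = {f \<in> fock_space. \<forall>j<m. (deriv ^^ j) f y = 0}"

text \<open>The maximal multi-valued operator induced by
  \<open>\<psi> \<cdot> f \<circ> \<phi> = \<Phi> \<cdot> g\<^sup>(\<^sup>m\<^sup>)\<close>: its domain and its values. The value at \<open>f\<close> is the set of all
  admissible \<open>g\<close>; it is meant for \<open>f\<close> in the domain.\<close>

definition smax_dom ::
    "nat \<Rightarrow> (complex \<Rightarrow> complex) \<Rightarrow> (complex \<Rightarrow> complex) \<Rightarrow> (complex \<Rightarrow> complex)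
      \<Rightarrow> (complex \<Rightarrow> complex) set" where
  "smax_dom m \<psi> \<phi> \<Phi> = {f \<in> fock_space. \<exists>g \<in> fock_space.
     \<forall>x. \<psi> x * f (\<phi> x) = \<Phi> x * (deriv ^^ m) g x}"

definition smax ::
    "nat \<Rightarrow> (complex \<Rightarrow> complex) \<Rightarrow> (complex \<Rightarrow> complex) \<Rightarrow> (complex \<Rightarrow> complex)
      \<Rightarrow> (complex \<Rightarrow> complex) \<Rightarrow> (complex \<Rightarrow> complex) set" where
  "smax m \<psi> \<phi> \<Phi> f = {g \<in> fock_space. \<forall>x. \<psi> x * f (\<phi> x) = \<Phi> x * (deriv ^^ m) g x}"

definition kern :: "complex \<Rightarrow> complex \<Rightarrow> complex" where
  "kern w x = exp (x * cnj w)"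

definition kern_k :: "nat \<Rightarrow> complex \<Rightarrow> complex \<Rightarrow> complex \<Rightarrow> complex \<Rightarrow> complex" where
  "kern_k k z a b x = (a * x + b) ^ k * exp (x * cnj z)"

definition poly_funs :: "nat \<Rightarrow> (complex \<Rightarrow> complex) set" where
  "poly_funs p = {poly q |q. degree q \<le> p}"

definition fscale :: "complex \<Rightarrow> (complex \<Rightarrow> complex) \<Rightarrow> complex \<Rightarrow> complex" where
  "fscale c f = (\<lambda>x. c * f x)"

text \<open>Translates of a complex linear subspace of dimension \<open>n\<close>. Since \<open>dim\<close> is \<open>0\<close> on
  infinite-dimensional spaces, finite dimensionality is required by means of a finite basis.\<close>

definition affine_of_dim :: "nat \<Rightarrow> (complex \<Rightarrow> complex) set \<Rightarrow> bool" where
  "affine_of_dim n S \<longleftrightarrow> (\<exists>f V. module.subspace fscale V \<and>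
     (\<exists>\<B>. finite \<B> \<and> module.span fscale \<B> = V) \<and>
     vector_space.dim fscale V = n \<and> S = (\<lambda>v. f + v) ` V)"

lemma vector_space_fscale: "vector_space fscale"
  by unfold_locales (auto simp: fscale_def fun_eq_iff algebra_simps)

lemma fock_norm_eq:
  "fock_norm f = sqrt ((\<integral>z. (norm (f z))\<^sup>2 * exp (- (norm z)\<^sup>2) \<partial>lborel) / pi)"
proof -
  have "f z * cnj (f z) * of_real (exp (- (norm z)\<^sup>2)) =
      complex_of_real ((norm (f z))\<^sup>2 * exp (- (norm z)\<^sup>2))" for z
    by (simp only: complex_norm_square of_real_mult)
  then show ?thesis
    unfolding fock_norm_def fock_inner_def
    by (simp only: integral_complex_of_real) simp
qed

lemma fock_norm_nonneg: "fock_norm f \<ge> 0"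
  by (simp add: fock_norm_eq)

lemma fock_space_diff:
  assumes "f \<in> fock_space" "g \<in> fock_space"
  shows "f - g \<in> fock_space"
proof -
  have hol: "f holomorphic_on UNIV" "g holomorphic_on UNIV"
    using assms by (auto simp: fock_space_def)
  have hol': "(\<lambda>x. f x - g x) holomorphic_on UNIV" by (intro holomorphic_intros hol)
  have "continuous_on UNIV (\<lambda>x. f x - g x)" using hol' by (rule holomorphic_on_imp_continuous_on)
  then have meas: "(\<lambda>x. f x - g x) \<in> borel_measurable borel"
    by (rule borel_measurable_continuous_onI)
  have le: "(norm (f z - g z))\<^sup>2 \<le> 2 * (norm (f z))\<^sup>2 + 2 * (norm (g z))\<^sup>2" for z
  proof -
    have "(norm (f z - g z))\<^sup>2 \<le> (norm (f z) + norm (g z))\<^sup>2"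
      by (intro power_mono norm_triangle_ineq4) simp
    also have "\<dots> \<le> 2 * (norm (f z))\<^sup>2 + 2 * (norm (g z))\<^sup>2"
      using sum_squares_bound[of "norm (f z)" "norm (g z)"] by (simp add: power2_sum)
    finally show ?thesis .
  qed
  have "integrable lborel (\<lambda>z::complex. (norm (f z - g z))\<^sup>2 * exp (- (norm z)\<^sup>2))"
  proof (rule Bochner_Integration.integrable_bound)
    show "integrable lborel (\<lambda>z::complex. 2 * ((norm (f z))\<^sup>2 * exp (- (norm z)\<^sup>2)) +
        2 * ((norm (g z))\<^sup>2 * exp (- (norm z)\<^sup>2)))"
      using assms by (auto simp: fock_space_def)
    show "(\<lambda>z::complex. (norm (f z - g z))\<^sup>2 * exp (- (norm z)\<^sup>2)) \<in> borel_measurable lborel"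
      using meas by measurable
    show "AE z in lborel. norm ((norm (f z - g z))\<^sup>2 * exp (- (norm z)\<^sup>2)) \<le>
        norm (2 * ((norm (f z))\<^sup>2 * exp (- (norm z)\<^sup>2)) + 2 * ((norm (g z))\<^sup>2 * exp (- (norm z)\<^sup>2)))"
    proof (rule AE_I2)
      fix z :: complex
      show "norm ((norm (f z - g z))\<^sup>2 * exp (- (norm z)\<^sup>2)) \<le>
        norm (2 * ((norm (f z))\<^sup>2 * exp (- (norm z)\<^sup>2)) + 2 * ((norm (g z))\<^sup>2 * exp (- (norm z)\<^sup>2)))"
        using mult_right_mono[OF le[of z], of "exp (- (norm z)\<^sup>2)"]
        by (simp add: algebra_simps)
    qed
  qed
  with hol' show ?thesis by (simp add: fock_space_def fun_diff_def)
qed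

lemma fock_norm_zero_iff:
  assumes "f \<in> fock_space"
  shows "fock_norm f = 0 \<longleftrightarrow> f = 0"
proof
  assume "fock_norm f = 0"
  then have "(\<integral>z. (norm (f z))\<^sup>2 * exp (- (norm z)\<^sup>2) \<partial>lborel) = 0"
    by (simp add: fock_norm_eq)
  then have "AE z in lborel. (norm (f z))\<^sup>2 * exp (- (norm z)\<^sup>2) = 0"
    using assms by (subst (asm) integral_nonneg_eq_0_iff_AE) (auto simp: fock_space_def)
  then have "AE z in lborel. f z = 0" by simp
  then have ae: "AE z in lebesgue. z \<in> UNIV \<longrightarrow> z \<in> {z. f z = 0}"
    by (intro AE_completion) simp
  have "f holomorphic_on UNIV" using assms by (simp add: fock_space_def)
  then have cont: "continuous_on UNIV f" by (rule holomorphic_on_imp_continuous_on)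
  have "closed {z. f z = 0}" by (rule closed_Collect_eq[OF cont continuous_on_const])
  from mem_closed_if_AE_lebesgue_open[OF open_UNIV this ae] have "f z = 0" for z by simp
  then show "f = 0" by (simp add: fun_eq_iff)
qed (simp add: fock_norm_eq)

lemma fock_norm_triangle:
  assumes f: "f \<in> fock_space" and g: "g \<in> fock_space" and fg: "f + g \<in> fock_space"
  shows "fock_norm (f + g) \<le> fock_norm f + fock_norm g"
proof (cases "fock_norm f = 0 \<or> fock_norm g = 0")
  case True
  then show ?thesis
    using fock_norm_zero_iff[OF f] fock_norm_zero_iff[OF g] by (auto simp: fock_norm_nonneg)
next
  case False
  define p q where "p = fock_norm f" and "q = fock_norm g"
  have pq: "p > 0" "q > 0"
    using False fock_norm_nonneg[of f] fock_norm_nonneg[of g] by (auto simp: p_def q_def)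
  define I where
    "I h = (\<integral>z. (norm (h z))\<^sup>2 * exp (- (norm z)\<^sup>2) \<partial>lborel)" for h :: "complex \<Rightarrow> complex"
  have I: "I h = pi * (fock_norm h)\<^sup>2" for h
    by (simp add: fock_norm_eq I_def)
  have le: "(norm (f z + g z))\<^sup>2 \<le> (1 + q/p) * (norm (f z))\<^sup>2 + (1 + p/q) * (norm (g z))\<^sup>2" for z
  proof -
    let ?u = "norm (f z)" and ?v = "norm (g z)"
    have "(norm (f z + g z))\<^sup>2 \<le> (?u + ?v)\<^sup>2" by (intro power_mono norm_triangle_ineq) simp
    also have "(1 + q/p) * ?u\<^sup>2 + (1 + p/q) * ?v\<^sup>2 - (?u + ?v)\<^sup>2 = (q * ?u - p * ?v)\<^sup>2 / (p * q)"
      using pq by (simp add: field_simps power2_eq_square)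
    then have "(?u + ?v)\<^sup>2 \<le> (1 + q/p) * ?u\<^sup>2 + (1 + p/q) * ?v\<^sup>2"
      using pq by (smt (verit) divide_nonneg_pos mult_pos_pos zero_le_power2)
    finally show ?thesis .
  qed
  have "I (f + g) \<le> (\<integral>z. (1 + q/p) * ((norm (f z))\<^sup>2 * exp (- (norm z)\<^sup>2)) +
      (1 + p/q) * ((norm (g z))\<^sup>2 * exp (- (norm z)\<^sup>2)) \<partial>lborel)"
    unfolding I_def
  proof (rule integral_mono)
    show "(norm ((f + g) z))\<^sup>2 * exp (- (norm z)\<^sup>2) \<le> (1 + q/p) * ((norm (f z))\<^sup>2 * exp (- (norm z)\<^sup>2)) +
      (1 + p/q) * ((norm (g z))\<^sup>2 * exp (- (norm z)\<^sup>2))" for z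
      using mult_right_mono[OF le[of z], of "exp (- (norm z)\<^sup>2)"]
      by (simp add: distrib_right mult.assoc)
  qed (use f g fg in \<open>auto simp: fock_space_def\<close>)
  also have "\<dots> = (1 + q/p) * I f + (1 + p/q) * I g"
    using f g unfolding I_def by (subst Bochner_Integration.integral_add) (auto simp: fock_space_def)
  also have "\<dots> = pi * (p + q)\<^sup>2"
    using pq by (simp add: I p_def[symmetric] q_def[symmetric] field_simps power2_eq_square)
  finally have "(fock_norm (f + g))\<^sup>2 \<le> (p + q)\<^sup>2" by (simp add: I)
  then have "fock_norm (f + g) \<le> p + q" by (rule power2_le_imp_le) (use pq in simp)
  then show ?thesis by (simp only: p_def q_def)
qed

lemma Metric_space_fock: "Metric_space fock_space fock_dist"
proof
  show "0 \<le> fock_dist f g" for f g by (simp add: fock_dist_def fock_norm_nonneg)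
  show "fock_dist f g = fock_dist g f" for f g
    by (simp add: fock_dist_def fock_norm_eq norm_minus_commute)
  show "fock_dist f g = 0 \<longleftrightarrow> f = g" if "f \<in> fock_space" "g \<in> fock_space" for f g
    using fock_norm_zero_iff[OF fock_space_diff[OF that]] by (simp add: fock_dist_def)
  show "fock_dist f h \<le> fock_dist f g + fock_dist g h"
    if "f \<in> fock_space" "g \<in> fock_space" "h \<in> fock_space" for f g h
    using fock_norm_triangle[of "f - g" "g - h"] that fock_space_diff
    by (simp add: fock_dist_def)
qed

end

theory Submission
  imports Defs "HOL-Probability.Distributions"
begin

text \<open>
Substituting \<open>w = A * x + B\<close> turns \<open>\<Phi> x = (a * \<phi> x + b) ^ m\<close> into
\<open>a ^ m * (w - y) ^ m\<close> with \<open>y = - b / a\<close>. Since \<open>\<psi>\<close> has no zeros, the defining equation says that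
\<open>f\<close> is \<open>(w - y) ^ m\<close> times an entire function built from the \<open>m\<close>-th derivative of \<open>g\<close>
(\<open>smax_dom_imp_factor\<close>). This gives the zero of order \<open>m\<close> of every \<open>f\<close> in the domain, and it excludes
the kernel functions with \<open>k < m\<close>, whose zero at \<open>y\<close> has order exactly \<open>k\<close>.

Conversely, if \<open>f w = (a * w + b) ^ m * h w\<close>, then \<open>g\<close> has to be an \<open>m\<close>-fold antiderivative of
\<open>\<psi> * (h \<circ> \<phi>)\<close>, and the one question is whether it lies in Fock space. For \<open>h\<close> of exponential
type it does: entire functions of exponential type are closed under products, affine substitutions
and antiderivatives, and all of them belong to Fock space (\<open>exp_type_imp_fock\<close>). So every
function \<open>(a * w + b) ^ m * h w\<close> with \<open>h\<close> of exponential type is in the domain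
(\<open>smax_dom_of_factor\<close>). For the kernel functions with \<open>k \<ge> m\<close>, all entire \<open>m\<close>-fold
antiderivatives are values of the operator; two of them differ by a polynomial of degree below \<open>m\<close>,
which yields the affine dimension and the explicit formula for \<open>k = m\<close>.

The closure needs two facts about Fock space: the functionals \<open>f \<mapsto> (deriv ^^ j) f y\<close> are bounded
(\<open>fock_higher_deriv_bounded\<close>), and the Taylor polynomials at \<open>0\<close> of an element converge to it in norm
(\<open>fock_taylor_polynomials_converge\<close>). Boundedness makes the space of functions with a zero of order \<open>m\<close>
at \<open>y\<close> closed. For density, let \<open>f\<close> be such a function and \<open>S\<close> one of its Taylor polynomials at \<open>0\<close>.
Re-expand \<open>S\<close> about \<open>y\<close> and drop the terms of degree below \<open>m\<close>. The dropped coefficients are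
derivatives at \<open>y\<close> of \<open>S - f\<close>, up to factorials, hence small by boundedness, and what remains of \<open>S\<close> is \<open>(x - y) ^ m\<close> times
a polynomial and so lies in the domain (\<open>fock_zeros_approximation\<close>).

Both facts come from one computation. For a radial weight \<open>w\<close>, rotation invariance of Lebesgue measure
makes the monomials orthogonal, so the weighted square integral of an entire function is the sum of
\<open>(norm (a n))\<^sup>2\<close> times the moment of \<open>w\<close> of order \<open>2 * n\<close> (\<open>parseval_radial_entire\<close>). The Gaussian weight, reached by
exhausting the plane with discs, gives convergence of the Taylor polynomials; the indicator of the
unit disc, applied to the translate of \<open>f\<close> by \<open>y\<close>, bounds each Taylor coefficient at \<open>y\<close>.
\<close>


section \<open>Rotation invariance of planar Lebesgue measure\<close>

lemma nn_integral_lborel_translate: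
  fixes h :: "'a::euclidean_space \<Rightarrow> ennreal"
  assumes [measurable]: "h \<in> borel_measurable borel"
  shows "(\<integral>\<^sup>+x. h (t + x) \<partial>lborel) = (\<integral>\<^sup>+x. h x \<partial>lborel)"
proof -
  have "(\<integral>\<^sup>+x. h x \<partial>lborel) = (\<integral>\<^sup>+x. h x \<partial>distr lborel borel (\<lambda>x. t + 1 *\<^sub>R x))"
    using lborel_affine[of 1 t] by (simp add: density_1)
  then show ?thesis by (simp add: nn_integral_distr)
qed

lemma nn_integral_lborel_reflect:
  fixes h :: "'a::euclidean_space \<Rightarrow> ennreal"
  assumes [measurable]: "h \<in> borel_measurable borel"
  shows "(\<integral>\<^sup>+x. h (t - x) \<partial>lborel) = (\<integral>\<^sup>+x. h x \<partial>lborel)"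
proof -
  have "(\<integral>\<^sup>+x. h x \<partial>lborel) = (\<integral>\<^sup>+x. h x \<partial>distr lborel borel (\<lambda>x. t + (-1) *\<^sub>R x))"
    using lborel_affine[of "-1" t] by (simp add: density_1)
  then show ?thesis by (simp add: nn_integral_distr)
qed

text \<open>
A short form of the uniqueness of Haar measure. With \<open>E\<close> the indicator of the unit disc, integrate
\<open>h (c * y + x) * E (c * y)\<close> over both variables. Integrating over \<open>x\<close> first gives the integral of \<open>h\<close>
times the area of the disc, because \<open>E\<close> is rotation invariant. Translating \<open>y\<close> by \<open>x / c\<close> and then
integrating over \<open>x\<close> gives the integral of \<open>h (c * y)\<close> times the same area.
\<close>

lemma nn_integral_lborel_rotate:
  fixes h :: "complex \<Rightarrow> ennreal" and c :: complex
  assumes [measurable]: "h \<in> borel_measurable borel" and c: "norm c = 1"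
  shows "(\<integral>\<^sup>+x. h (c * x) \<partial>lborel) = (\<integral>\<^sup>+x. h x \<partial>lborel)"
proof -
  define E :: "complex \<Rightarrow> ennreal" where "E = indicator (ball 0 1)"
  have [measurable]: "E \<in> borel_measurable borel" unfolding E_def by (rule borel_measurable_indicator) simp
  have cnz: "c \<noteq> 0" using c by auto
  have E_rot: "E (c * y) = E y" for y using c by (simp add: E_def indicator_def norm_mult)
  define V where "V = (\<integral>\<^sup>+x. E x \<partial>lborel)"
  have "V = emeasure lborel (ball (0::complex) 1)" by (simp add: V_def E_def)
  moreover have "emeasure lborel (ball (0::complex) 1) < \<infinity>"
    by (rule emeasure_bounded_finite) simp
  moreover have "emeasure lborel (ball (0::complex) 1) \<noteq> 0"
    using open_not_negligible[of "ball (0::complex) 1"]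
    by (auto simp: negligible_iff_null_sets null_sets_def)
  ultimately have V: "V \<noteq> 0" "V \<noteq> top" by auto
  have "(\<integral>\<^sup>+x. h x \<partial>lborel) * V = (\<integral>\<^sup>+y. (\<integral>\<^sup>+x. h (c * y + x) \<partial>lborel) * E (c * y) \<partial>lborel)"
    by (simp add: nn_integral_lborel_translate E_rot nn_integral_cmult V_def)
  also have "\<dots> = (\<integral>\<^sup>+y. (\<integral>\<^sup>+x. h (c * y + x) * E (c * y) \<partial>lborel) \<partial>lborel)"
    by (simp add: nn_integral_multc)
  also have "\<dots> = (\<integral>\<^sup>+x. (\<integral>\<^sup>+y. h (c * y + x) * E (c * y) \<partial>lborel) \<partial>lborel)"
    by (rule lborel_pair.Fubini') simp
  also have "\<dots> = (\<integral>\<^sup>+x. (\<integral>\<^sup>+y. h (c * y) * E (c * y - x) \<partial>lborel) \<partial>lborel)"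
  proof (rule nn_integral_cong)
    fix x
    show "(\<integral>\<^sup>+y. h (c * y + x) * E (c * y) \<partial>lborel) = (\<integral>\<^sup>+y. h (c * y) * E (c * y - x) \<partial>lborel)"
      using nn_integral_lborel_translate[of "\<lambda>y. h (c * y) * E (c * y - x)" "x / c"] cnz
      by (simp add: algebra_simps)
  qed
  also have "\<dots> = (\<integral>\<^sup>+y. (\<integral>\<^sup>+x. h (c * y) * E (c * y - x) \<partial>lborel) \<partial>lborel)"
    by (rule lborel_pair.Fubini') simp
  also have "\<dots> = (\<integral>\<^sup>+y. h (c * y) * V \<partial>lborel)"
    by (simp add: nn_integral_cmult nn_integral_lborel_reflect V_def)
  also have "\<dots> = (\<integral>\<^sup>+y. h (c * y) \<partial>lborel) * V" by (simp add: nn_integral_multc)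
  finally show ?thesis using V by (metis mult_divide_eq_ennreal)
qed

lemma lborel_distr_rotate:
  assumes c: "norm (c::complex) = 1"
  shows "distr lborel borel ((*) c) = lborel"
proof (rule measure_eqI)
  fix X assume "X \<in> sets (distr lborel borel ((*) c))"
  then have [measurable]: "X \<in> sets borel" by simp
  have "emeasure (distr lborel borel ((*) c)) X = (\<integral>\<^sup>+x. indicator X (c * x) \<partial>lborel)"
    using nn_integral_distr[of "(*) c" lborel borel "indicator X"] by simp
  also have "\<dots> = emeasure lborel X" by (subst nn_integral_lborel_rotate[OF _ c]) auto
  finally show "emeasure (distr lborel borel ((*) c)) X = emeasure lborel X" .
qed simp

lemma integral_lborel_rotate:
  fixes h :: "complex \<Rightarrow> complex" and c :: complex
  assumes "h \<in> borel_measurable borel" and "norm c = 1"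
  shows "(\<integral>x. h (c * x) \<partial>lborel) = (\<integral>x. h x \<partial>lborel)"
  using assms integral_distr[of "(*) c" lborel borel h] by (simp add: lborel_distr_rotate)


section \<open>Parseval's identity for radial weights\<close>

text \<open>
A rotation by an angle \<open>t\<close> multiplies the integral by \<open>cis ((n - k) * t)\<close>; the angle is chosen so that
this factor is \<open>-1\<close>.
\<close>

lemma integral_radial_monomials:
  fixes w :: "complex \<Rightarrow> real"
  assumes [measurable]: "w \<in> borel_measurable borel"
    and rot: "\<And>c z. norm c = 1 \<Longrightarrow> w (c * z) = w z" and "n \<noteq> k"
  shows "(\<integral>z. z ^ n * cnj z ^ k * of_real (w z) \<partial>lborel) = 0" (is "?I = 0")
proof -
  define t where "t = pi / (real n - real k)"
  have eq: "cis t ^ n * cnj (cis t) ^ k = -1"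
  proof -
    have "cis t ^ n * cnj (cis t) ^ k = cis (real n * t + real k * (- t))"
      by (simp only: cis_cnj Complex.DeMoivre cis_mult)
    also have "real n * t + real k * (- t) = (real n - real k) * t" by (simp add: algebra_simps)
    also have "(real n - real k) * t = pi" using \<open>n \<noteq> k\<close> by (simp add: t_def)
    finally show ?thesis by simp
  qed
  have "?I = (\<integral>z. (cis t * z) ^ n * cnj (cis t * z) ^ k * of_real (w (cis t * z)) \<partial>lborel)"
  proof (rule integral_lborel_rotate[symmetric])
    have "(\<lambda>z. z ^ n * cnj z ^ k) \<in> borel_measurable borel"
      by (intro borel_measurable_continuous_onI continuous_intros)
    then show "(\<lambda>z. z ^ n * cnj z ^ k * of_real (w z)) \<in> borel_measurable borel" by measurable
  qed simp
  also have "\<dots> = (\<integral>z. - (z ^ n * cnj z ^ k * of_real (w z)) \<partial>lborel)"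
  proof (rule Bochner_Integration.integral_cong[OF refl])
    fix z :: complex
    have "(cis t * z) ^ n * cnj (cis t * z) ^ k * of_real (w (cis t * z)) =
        (cis t ^ n * cnj (cis t) ^ k) * (z ^ n * cnj z ^ k * of_real (w z))"
      by (simp add: power_mult_distrib rot)
    then show "(cis t * z) ^ n * cnj (cis t * z) ^ k * of_real (w (cis t * z)) =
        - (z ^ n * cnj z ^ k * of_real (w z))" by (simp add: eq)
  qed
  also have "\<dots> = - ?I" by simp
  finally show ?thesis by simp
qed

lemma parseval_radial_polynomial:
  fixes w :: "complex \<Rightarrow> real" and a :: "nat \<Rightarrow> complex"
  assumes [measurable]: "w \<in> borel_measurable borel"
    and rot: "\<And>c z. norm c = 1 \<Longrightarrow> w (c * z) = w z"
    and int: "\<And>n. integrable lborel (\<lambda>z. norm z ^ n * w z)"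
  shows "(\<integral>z. (norm (\<Sum>n<N. a n * z ^ n))\<^sup>2 * w z \<partial>lborel) =
      (\<Sum>n<N. (norm (a n))\<^sup>2 * (\<integral>z. norm z ^ (2 * n) * w z \<partial>lborel))"
proof -
  have int': "integrable lborel (\<lambda>z. z ^ n * cnj z ^ k * of_real (w z))" for n k
  proof (rule Bochner_Integration.integrable_bound[OF int[of "n + k"]])
    have "(\<lambda>z. z ^ n * cnj z ^ k) \<in> borel_measurable borel"
      by (intro borel_measurable_continuous_onI continuous_intros)
    then show "(\<lambda>z. z ^ n * cnj z ^ k * of_real (w z)) \<in> borel_measurable lborel"
      by measurable
  qed (auto simp: norm_mult norm_power power_add)
  have diag: "(\<integral>z. z ^ n * cnj z ^ n * of_real (w z) \<partial>lborel) =
      of_real (\<integral>z. norm z ^ (2 * n) * w z \<partial>lborel)" for n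
    unfolding integral_complex_of_real[symmetric]
    by (intro Bochner_Integration.integral_cong)
      (simp_all add: power_mult_distrib[symmetric] complex_norm_square[symmetric] power_mult)
  have square: "complex_of_real ((norm (\<Sum>n<N. a n * z ^ n))\<^sup>2 * w z) =
      (\<Sum>n<N. \<Sum>k<N. a n * cnj (a k) * (z ^ n * cnj z ^ k * of_real (w z)))" for z
    by (simp only: of_real_mult complex_norm_square cnj_sum sum_product)
      (simp add: sum_distrib_right sum_distrib_left mult_ac)
  have "complex_of_real (\<integral>z. (norm (\<Sum>n<N. a n * z ^ n))\<^sup>2 * w z \<partial>lborel) =
      (\<integral>z. (\<Sum>n<N. \<Sum>k<N. a n * cnj (a k) * (z ^ n * cnj z ^ k * of_real (w z))) \<partial>lborel)"
    unfolding integral_complex_of_real[symmetric]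
    by (simp only: square)
  also have "\<dots> = (\<Sum>n<N. \<Sum>k<N. a n * cnj (a k) * (\<integral>z. z ^ n * cnj z ^ k * of_real (w z) \<partial>lborel))"
    by (simp add: Bochner_Integration.integral_sum int')
  also have "\<dots> = (\<Sum>n<N. \<Sum>k<N. if k = n then
      a n * cnj (a n) * (\<integral>z. z ^ n * cnj z ^ n * of_real (w z) \<partial>lborel) else 0)"
    by (intro sum.cong refl) (auto simp: integral_radial_monomials rot)
  also have "\<dots> = (\<Sum>n<N. of_real ((norm (a n))\<^sup>2) * of_real (\<integral>z. norm z ^ (2 * n) * w z \<partial>lborel))"
    by (intro sum.cong refl) (simp add: diag complex_norm_square[symmetric])
  finally show ?thesis
    by (simp only: of_real_mult[symmetric] of_real_sum[symmetric] of_real_eq_iff)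
qed

text \<open>
The bounded support makes the passage to the limit easy: on the disc of radius \<open>R\<close> all partial sums
are bounded by \<open>T\<close>, the value at \<open>R\<close> of the series of absolute values, so dominated convergence applies.
The Gaussian weight is reached from such weights by exhaustion.
\<close>

lemma parseval_radial_entire:
  fixes w :: "complex \<Rightarrow> real" and a :: "nat \<Rightarrow> complex" and R :: real
  assumes [measurable]: "w \<in> borel_measurable borel"
    and rot: "\<And>c z. norm c = 1 \<Longrightarrow> w (c * z) = w z"
    and nonneg: "\<And>z. w z \<ge> 0" and int: "integrable lborel w"
    and supp: "\<And>z. norm z > R \<Longrightarrow> w z = 0" and R: "R > 0"
    and sums: "\<And>z. (\<lambda>n. a n * z ^ n) sums f z"
  shows "(\<lambda>n. (norm (a n))\<^sup>2 * (\<integral>z. norm z ^ (2 * n) * w z \<partial>lborel)) sums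
      (\<integral>z. (norm (f z))\<^sup>2 * w z \<partial>lborel)"
proof -
  have int': "integrable lborel (\<lambda>z. norm z ^ n * w z)" for n
  proof (rule Bochner_Integration.integrable_bound)
    show "integrable lborel (\<lambda>z. R ^ n * w z)" using int by simp
    show "AE z in lborel. norm (norm z ^ n * w z) \<le> norm (R ^ n * w z)"
    proof (rule AE_I2)
      fix z :: complex
      show "norm (norm z ^ n * w z) \<le> norm (R ^ n * w z)"
        using R nonneg[of z] by (cases "norm z \<le> R") (auto simp: supp intro!: mult_right_mono power_mono)
    qed
  qed simp
  \<comment> \<open>Convergence at the larger radius \<open>R + 1\<close> gives absolute convergence at \<open>R\<close>.\<close>
  have summ: "summable (\<lambda>n. norm (a n * of_real R ^ n))"
    by (rule powser_insidea[where x = "of_real (R + 1)"]) (use sums R in \<open>auto intro: sums_summable\<close>)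
  define T where "T = (\<Sum>n. norm (a n * of_real R ^ n))"
  have S_le: "norm (\<Sum>n<N. a n * z ^ n) \<le> T" if "norm z \<le> R" for N z
  proof -
    have "norm (\<Sum>n<N. a n * z ^ n) \<le> (\<Sum>n<N. norm (a n * of_real R ^ n))"
      using R that by (intro sum_norm_le) (auto simp: norm_mult norm_power intro!: mult_left_mono power_mono)
    also have "\<dots> \<le> T" unfolding T_def by (rule sum_le_suminf[OF summ]) auto
    finally show ?thesis .
  qed
  have [measurable]: "f \<in> borel_measurable borel"
    by (rule borel_measurable_LIMSEQ_metric[where f = "\<lambda>N z. \<Sum>n<N. a n * z ^ n"])
      (use sums in \<open>auto simp: sums_def\<close>)
  have "(\<lambda>N. (\<integral>z. (norm (\<Sum>n<N. a n * z ^ n))\<^sup>2 * w z \<partial>lborel)) \<longlonglongrightarrow>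
      (\<integral>z. (norm (f z))\<^sup>2 * w z \<partial>lborel)"
  proof (rule integral_dominated_convergence[where w = "\<lambda>z. T\<^sup>2 * w z"])
    show "AE z in lborel. (\<lambda>N. (norm (\<Sum>n<N. a n * z ^ n))\<^sup>2 * w z) \<longlonglongrightarrow> (norm (f z))\<^sup>2 * w z"
      using sums by (intro AE_I2 tendsto_intros) (simp add: sums_def)
    show "AE z in lborel. norm ((norm (\<Sum>n<N. a n * z ^ n))\<^sup>2 * w z) \<le> T\<^sup>2 * w z" for N
    proof (rule AE_I2)
      fix z :: complex
      show "norm ((norm (\<Sum>n<N. a n * z ^ n))\<^sup>2 * w z) \<le> T\<^sup>2 * w z"
        using S_le[of z N] nonneg[of z]
        by (cases "norm z \<le> R") (auto simp: supp intro!: mult_right_mono power_mono)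
    qed
  qed (use int in auto)
  then show ?thesis by (simp add: sums_def parseval_radial_polynomial[OF _ rot int'])
qed


section \<open>Entire functions of exponential type\<close>

text \<open>
The class of entire functions of finite exponential type: large enough for polynomials
and kernel functions, small enough for Fock space, and stable under all constructions used below.
\<close>

definition exp_type :: "(complex \<Rightarrow> complex) set" where
  "exp_type = {f. f holomorphic_on UNIV \<and> (\<exists>M c. \<forall>x. norm (f x) \<le> M * exp (c * norm x))}"

lemma exp_typeI:
  assumes "f holomorphic_on UNIV" "\<And>x. norm (f x) \<le> M * exp (c * norm x)"
  shows "f \<in> exp_type"
  using assms by (auto simp: exp_type_def)

lemma exp_type_holomorphic: "f \<in> exp_type \<Longrightarrow> f holomorphic_on UNIV"
  by (simp add: exp_type_def)

text \<open>
Nonnegative constants make the bound monotone in \<open>norm x\<close>.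
\<close>

lemma exp_typeE:
  assumes "f \<in> exp_type"
  obtains M c where "M \<ge> 0" "c \<ge> 0" "\<forall>x. norm (f x) \<le> M * exp (c * norm x)"
proof -
  obtain M c where le: "\<And>x. norm (f x) \<le> M * exp (c * norm x)"
    using assms by (auto simp: exp_type_def)
  have "norm (f x) \<le> \<bar>M\<bar> * exp (\<bar>c\<bar> * norm x)" for x
    by (rule order_trans[OF le mult_mono]) (auto intro: mult_right_mono)
  with that[of "\<bar>M\<bar>" "\<bar>c\<bar>"] show ?thesis by simp
qed

lemma exp_type_mult:
  assumes "f \<in> exp_type" "g \<in> exp_type" shows "(\<lambda>x. f x * g x) \<in> exp_type"
proof -
  obtain M c where f: "M \<ge> 0" "c \<ge> 0" "\<forall>x. norm (f x) \<le> M * exp (c * norm x)"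
    using assms(1) by (rule exp_typeE)
  obtain M' c' where g: "M' \<ge> 0" "c' \<ge> 0" "\<forall>x. norm (g x) \<le> M' * exp (c' * norm x)"
    using assms(2) by (rule exp_typeE)
  show ?thesis
  proof (rule exp_typeI)
    show "(\<lambda>x. f x * g x) holomorphic_on UNIV"
      using assms by (intro holomorphic_intros exp_type_holomorphic)
    show "norm (f x * g x) \<le> (M * M') * exp ((c + c') * norm x)" for x
      using mult_mono[OF f(3)[rule_format, of x] g(3)[rule_format, of x]] f(1) by (simp add: norm_mult exp_add algebra_simps)
  qed
qed

lemma exp_type_add:
  assumes "f \<in> exp_type" "g \<in> exp_type" shows "(\<lambda>x. f x + g x) \<in> exp_type"
proof -
  obtain M c where f: "M \<ge> 0" "c \<ge> 0" "\<forall>x. norm (f x) \<le> M * exp (c * norm x)"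
    using assms(1) by (rule exp_typeE)
  obtain M' c' where g: "M' \<ge> 0" "c' \<ge> 0" "\<forall>x. norm (g x) \<le> M' * exp (c' * norm x)"
    using assms(2) by (rule exp_typeE)
  show ?thesis
  proof (rule exp_typeI)
    show "(\<lambda>x. f x + g x) holomorphic_on UNIV"
      using assms by (intro holomorphic_intros exp_type_holomorphic)
    fix x :: complex
    have "norm (f x + g x) \<le> M * exp (c * norm x) + M' * exp (c' * norm x)"
      by (rule norm_triangle_mono[OF f(3)[rule_format] g(3)[rule_format]])
    also have "\<dots> \<le> M * exp ((c + c') * norm x) + M' * exp ((c + c') * norm x)"
      using f g by (intro add_mono mult_left_mono) (auto intro!: mult_right_mono)
    finally show "norm (f x + g x) \<le> (M + M') * exp ((c + c') * norm x)"
      by (simp add: distrib_right)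
  qed
qed

lemma exp_type_const: "(\<lambda>x. c) \<in> exp_type"
  by (rule exp_typeI[of _ "norm c" 0]) auto

lemma exp_type_ident: "(\<lambda>x. x) \<in> exp_type"
proof (rule exp_typeI)
  show "norm x \<le> 1 * exp (1 * norm x)" for x :: complex
    using exp_ge_add_one_self[of "norm x"] by (simp del: exp_ge_add_one_self)
qed (intro holomorphic_intros)

lemma exp_type_exp: "(\<lambda>x. exp (c * x)) \<in> exp_type"
proof (rule exp_typeI)
  show "norm (exp (c * x)) \<le> 1 * exp (norm c * norm x)" for x
    using complex_Re_le_cmod[of "c * x"] by (simp add: norm_mult)
qed (intro holomorphic_intros)

lemma exp_type_diff:
  assumes "f \<in> exp_type" "g \<in> exp_type" shows "(\<lambda>x. f x - g x) \<in> exp_type"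
  using exp_type_add[OF assms(1) exp_type_mult[OF exp_type_const[of "-1"] assms(2)]] by simp

lemma exp_type_power: "f \<in> exp_type \<Longrightarrow> (\<lambda>x. f x ^ n) \<in> exp_type"
  by (induction n) (auto intro: exp_type_mult exp_type_const)

lemma exp_type_sum: "(\<And>i. i \<in> I \<Longrightarrow> f i \<in> exp_type) \<Longrightarrow> (\<lambda>x. \<Sum>i\<in>I. f i x) \<in> exp_type"
  by (induction I rule: infinite_finite_induct) (auto intro: exp_type_add exp_type_const)

lemmas exp_type_intros =
  exp_type_mult exp_type_add exp_type_diff exp_type_const exp_type_ident exp_type_exp exp_type_power exp_type_sum

lemma exp_type_affine:
  assumes "h \<in> exp_type" shows "(\<lambda>x. h (A * x + B)) \<in> exp_type"
proof -
  obtain M c where M: "M \<ge> 0" "c \<ge> 0" "\<forall>x. norm (h x) \<le> M * exp (c * norm x)"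
    using assms by (rule exp_typeE)
  show ?thesis
  proof (rule exp_typeI)
    have "h holomorphic_on UNIV" using assms by (rule exp_type_holomorphic)
    then have "(h \<circ> (\<lambda>x. A * x + B)) holomorphic_on UNIV"
      by (intro holomorphic_on_compose_gen[where t = UNIV] holomorphic_intros) auto
    then show "(\<lambda>x. h (A * x + B)) holomorphic_on UNIV" by (simp add: o_def)
    fix x
    have "c * norm (A * x + B) \<le> c * (norm A * norm x + norm B)"
      using M norm_triangle_ineq[of "A * x" B] by (intro mult_left_mono) (auto simp: norm_mult)
    then have "exp (c * norm (A * x + B)) \<le> exp (c * norm B) * exp (c * norm A * norm x)"
      by (simp add: exp_add[symmetric] algebra_simps)
    then have "M * exp (c * norm (A * x + B)) \<le> M * (exp (c * norm B) * exp (c * norm A * norm x))"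
      using M by (intro mult_left_mono)
    then show "norm (h (A * x + B)) \<le> (M * exp (c * norm B)) * exp ((c * norm A) * norm x)"
      using M(3)[rule_format, of "A * x + B"] by (simp add: mult.assoc)
  qed
qed

text \<open>
By the mean value inequality on the disc of radius \<open>norm x\<close>, the distance of \<open>f x\<close> from \<open>f 0\<close> exceeds the
bound for the derivative by at most a factor \<open>norm x\<close>, which \<open>exp (norm x)\<close> absorbs.
\<close>

lemma exp_type_antiderivative:
  assumes hol: "f holomorphic_on UNIV" and "deriv f \<in> exp_type"
  shows "f \<in> exp_type"
proof -
  obtain M c where M: "M \<ge> 0" "c \<ge> 0" and le: "\<forall>x. norm (deriv f x) \<le> M * exp (c * norm x)"
    using assms(2) by (rule exp_typeE)
  show ?thesis
  proof (rule exp_typeI[OF hol])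
    fix x :: complex
    have "norm (f x - f 0) \<le> M * exp (c * norm x) * norm (x - 0)"
    proof (rule field_differentiable_bound[where S = "cball 0 (norm x)" and f' = "deriv f"])
      fix y :: complex assume y: "y \<in> cball 0 (norm x)"
      show "(f has_field_derivative deriv f y) (at y within cball 0 (norm x))"
        by (rule has_field_derivative_at_within, rule holomorphic_derivI[OF hol]) auto
      have "exp (c * norm y) \<le> exp (c * norm x)" using y M by (simp add: mult_left_mono)
      then show "norm (deriv f y) \<le> M * exp (c * norm x)"
        using le[rule_format, of y] M by (meson mult_left_mono order_trans)
    qed auto
    then have "norm (f x) \<le> norm (f 0) * 1 + M * exp (c * norm x) * norm x"
      using norm_triangle_ineq2[of "f x" "f 0"] by simp
    also have "\<dots> \<le> norm (f 0) * exp ((c + 1) * norm x) + M * exp (c * norm x) * exp (norm x)"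
      using M order_trans[OF _ exp_ge_add_one_self, of "norm x" "norm x"]
      by (intro add_mono mult_left_mono) auto
    also have "\<dots> = (norm (f 0) + M) * exp ((c + 1) * norm x)"
      by (simp add: distrib_right exp_add)
    finally show "norm (f x) \<le> (norm (f 0) + M) * exp ((c + 1) * norm x)" .
  qed
qed

lemma exp_type_iterated_antiderivative:
  "f holomorphic_on UNIV \<Longrightarrow> (deriv ^^ m) f \<in> exp_type \<Longrightarrow> f \<in> exp_type"
proof (induction m arbitrary: f)
  case (Suc m)
  have "deriv f \<in> exp_type"
  proof (rule Suc.IH)
    show "deriv f holomorphic_on UNIV" using Suc.prems(1) by (intro holomorphic_deriv) auto
    show "(deriv ^^ m) (deriv f) \<in> exp_type"
      using Suc.prems(2) by (simp add: funpow_Suc_right del: funpow.simps)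
  qed
  with Suc.prems(1) show ?case by (rule exp_type_antiderivative)
qed simp

lemma integrable_complex_gaussian:
  "integrable lborel (\<lambda>z::complex. exp (- (norm z)\<^sup>2 / 2))"
proof (rule integrableI_nonneg)
  have "(\<integral>\<^sup>+z. ennreal (exp (- (norm z)\<^sup>2 / 2)) \<partial>(lborel::complex measure)) =
      (\<integral>\<^sup>+z. (\<Prod>b\<in>Basis. ennreal (exp (- (z \<bullet> b)\<^sup>2 / 2))) \<partial>(lborel::complex measure))"
    by (intro nn_integral_cong)
      (simp add: Basis_complex_def inner_complex_def cmod_def complex_i_not_one
        ennreal_mult'[symmetric] exp_add[symmetric] add_divide_distrib[symmetric]
        prod.insert)
  also have "\<dots> = (\<Prod>b\<in>(Basis::complex set). (\<integral>\<^sup>+x. ennreal (exp (- x\<^sup>2 / 2)) \<partial>lborel))"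
    by (subst nn_integral_lborel_prod) auto
  also have "\<dots> < \<infinity>"
  proof -
    have "integrable lborel (\<lambda>x::real. std_normal_density x * sqrt (2 * pi))"
      by (intro integrable_mult_left) (rule integrable_normal_density, simp)
    then have "integrable lborel (\<lambda>x::real. exp (- x\<^sup>2 / 2))"
      by (simp add: std_normal_density_def)
    then have "(\<integral>\<^sup>+x. ennreal (exp (- x\<^sup>2 / 2)) \<partial>lborel) < \<infinity>"
      using integrableD(2)[of lborel "\<lambda>x::real. exp (- x\<^sup>2 / 2)"] by (simp add: less_top)
    then show ?thesis by (simp add: Basis_complex_def ennreal_mult_less_top)
  qed
  finally show "(\<integral>\<^sup>+z. ennreal (exp (- (norm z)\<^sup>2 / 2)) \<partial>(lborel::complex measure)) < \<infinity>" .
qed auto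

text \<open>
Completing the square, \<open>2 * c * r - r\<^sup>2 \<le> 2 * c\<^sup>2 - r\<^sup>2 / 2\<close>, so half of the Gaussian decay is enough to absorb
the exponential growth and the other half is integrable.
\<close>

lemma exp_type_imp_fock:
  assumes "f \<in> exp_type" shows "f \<in> fock_space"
proof -
  obtain M c where f: "M \<ge> 0" "c \<ge> 0" "\<forall>x. norm (f x) \<le> M * exp (c * norm x)"
    using assms by (rule exp_typeE)
  have hol: "f holomorphic_on UNIV" using assms by (rule exp_type_holomorphic)
  have [measurable]: "f \<in> borel_measurable borel"
    by (intro borel_measurable_continuous_onI holomorphic_on_imp_continuous_on hol)
  have "integrable lborel (\<lambda>z::complex. (norm (f z))\<^sup>2 * exp (- (norm z)\<^sup>2))"
  proof (rule Bochner_Integration.integrable_bound)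
    show "integrable lborel (\<lambda>z::complex. (M\<^sup>2 * exp (2 * c\<^sup>2)) * exp (- (norm z)\<^sup>2 / 2))"
      by (intro integrable_mult_right integrable_complex_gaussian)
    show "AE z in lborel. norm ((norm (f z))\<^sup>2 * exp (- (norm z)\<^sup>2)) \<le>
        norm (M\<^sup>2 * exp (2 * c\<^sup>2) * exp (- (norm z)\<^sup>2 / 2))"
    proof (rule AE_I2)
      fix z :: complex
      have "2 * c * norm z - (norm z)\<^sup>2 \<le> 2 * c\<^sup>2 - (norm z)\<^sup>2 / 2"
        using zero_le_power2[of "norm z - 2 * c"] by (simp add: power2_eq_square algebra_simps)
      then have e: "exp (2 * c * norm z - (norm z)\<^sup>2) \<le> exp (2 * c\<^sup>2 - (norm z)\<^sup>2 / 2)"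
        by simp
      have "(norm (f z))\<^sup>2 * exp (- (norm z)\<^sup>2) \<le> (M * exp (c * norm z))\<^sup>2 * exp (- (norm z)\<^sup>2)"
        by (intro mult_right_mono power_mono f(3)[rule_format]) auto
      also have "\<dots> = M\<^sup>2 * (exp (c * norm z) * exp (c * norm z) * exp (- (norm z)\<^sup>2))"
        by (simp add: power2_eq_square[of "M * _"] power2_eq_square[of M])
      also have "exp (c * norm z) * exp (c * norm z) * exp (- (norm z)\<^sup>2) =
          exp (2 * c * norm z - (norm z)\<^sup>2)"
        unfolding exp_add[symmetric] by (rule arg_cong[where f = exp]) simp
      also have "M\<^sup>2 * exp (2 * c * norm z - (norm z)\<^sup>2) \<le> M\<^sup>2 * exp (2 * c\<^sup>2 - (norm z)\<^sup>2 / 2)"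
        using e by (intro mult_left_mono) auto
      also have "exp (2 * c\<^sup>2 - (norm z)\<^sup>2 / 2) = exp (2 * c\<^sup>2) * exp (- (norm z)\<^sup>2 / 2)"
        unfolding exp_add[symmetric] by (rule arg_cong[where f = exp]) simp
      finally show "norm ((norm (f z))\<^sup>2 * exp (- (norm z)\<^sup>2)) \<le>
        norm (M\<^sup>2 * exp (2 * c\<^sup>2) * exp (- (norm z)\<^sup>2 / 2))" by (simp add: mult.assoc)
    qed
  qed simp
  with hol show ?thesis by (simp add: fock_space_def)
qed


section \<open>Iterated antiderivatives of entire functions\<close>

lemma entire_iterated_antiderivative_exists:
  fixes h :: "complex \<Rightarrow> complex"
  assumes "h holomorphic_on UNIV"
  shows "\<exists>g. g holomorphic_on UNIV \<and> (deriv ^^ m) g = h"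
proof (induction m)
  case 0 then show ?case using assms by (intro exI[of _ h]) simp
next
  case (Suc m)
  then obtain g where g: "g holomorphic_on UNIV" "(deriv ^^ m) g = h" by blast
  obtain G where G: "\<And>x. (G has_field_derivative g x) (at x)"
    using holomorphic_convex_primitive'[OF convex_UNIV open_UNIV g(1)] by auto
  have "deriv G = g" using G by (auto simp: fun_eq_iff intro: DERIV_imp_deriv)
  moreover have "G holomorphic_on UNIV"
    using G by (auto simp: holomorphic_on_open)
  ultimately show ?case using g by (intro exI[of _ G]) (simp add: funpow_Suc_right del: funpow.simps)
qed

lemma entire_eq_taylor_polynomial:
  assumes v: "v holomorphic_on UNIV" and "\<forall>x. (deriv ^^ m) v x = 0"
  shows "v x = (\<Sum>n<m. (deriv ^^ n) v y / fact n * (x - y) ^ n)"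
proof -
  have zero: "(deriv ^^ n) v y = 0" if "n \<ge> m" for n
  proof -
    have "(deriv ^^ k) (\<lambda>x. 0) = (\<lambda>x. 0 :: complex)" for k
      by (induction k) auto
    moreover have "(deriv ^^ m) v = (\<lambda>x. 0)" using assms(2) by auto
    moreover have "(deriv ^^ n) v = (deriv ^^ (n - m)) ((deriv ^^ m) v)"
      using that by (metis funpow_add o_apply le_add_diff_inverse2)
    ultimately show ?thesis by simp
  qed
  have "(\<lambda>n. (deriv ^^ n) v y / fact n * (x - y) ^ n) sums v x"
    by (rule holomorphic_power_series[where r = "dist y x + 1"])
      (auto intro: holomorphic_on_subset[OF v])
  moreover have "(\<lambda>n. (deriv ^^ n) v y / fact n * (x - y) ^ n) sums
      (\<Sum>n<m. (deriv ^^ n) v y / fact n * (x - y) ^ n)"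
    by (rule sums_finite) (auto simp: zero)
  ultimately show ?thesis by (rule sums_unique2)
qed

lemma higher_deriv_poly_eq_0:
  "degree (q :: complex poly) < m \<Longrightarrow> (deriv ^^ m) (poly q) x = 0"
proof -
  have D: "deriv (poly p) = poly (pderiv p)" for p :: "complex poly"
    by (auto simp: fun_eq_iff intro!: DERIV_imp_deriv poly_DERIV)
  have D0: "(deriv ^^ k) (poly 0) = (poly 0 :: complex \<Rightarrow> complex)" for k
    by (induction k) (simp_all add: D)
  have "\<And>q::complex poly. degree q < m \<Longrightarrow> (deriv ^^ m) (poly q) = poly 0"
  proof (induction m)
    case (Suc m)
    show ?case
    proof (cases "degree q = 0")
      case True
      then have "pderiv q = 0" by (simp add: pderiv_eq_0_iff)
      then show ?thesis by (simp add: funpow_Suc_right D D0 del: funpow.simps poly_0)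
    next
      case False
      then show ?thesis using Suc by (simp add: funpow_Suc_right D degree_pderiv del: funpow.simps)
    qed
  qed simp
  then show "degree q < m \<Longrightarrow> (deriv ^^ m) (poly q) x = 0" by simp
qed

lemma entire_deriv_eq_0_iff_poly:
  assumes v: "v holomorphic_on UNIV" and m: "m \<ge> 1"
  shows "(\<forall>x. (deriv ^^ m) v x = 0) \<longleftrightarrow> v \<in> poly_funs (m - 1)"
proof
  assume z: "\<forall>x. (deriv ^^ m) v x = 0"
  define q where "q = (\<Sum>n<m. monom ((deriv ^^ n) v 0 / fact n) n)"
  have "v x = poly q x" for x
    using entire_eq_taylor_polynomial[OF v z, of x 0] by (simp add: q_def poly_sum poly_monom)
  moreover have "degree q \<le> m - 1"
    unfolding q_def by (rule degree_sum_le) (auto intro: order_trans[OF degree_monom_le])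
  ultimately show "v \<in> poly_funs (m - 1)" by (auto simp: poly_funs_def)
next
  assume "v \<in> poly_funs (m - 1)"
  then show "\<forall>x. (deriv ^^ m) v x = 0" using m by (auto simp: poly_funs_def intro!: higher_deriv_poly_eq_0)
qed

lemma sum_fun_eval: "(\<Sum>i\<in>I. F i) x = (\<Sum>i\<in>I. F i x)"
  for F :: "'i \<Rightarrow> 'b \<Rightarrow> complex"
  by (induction I rule: infinite_finite_induct) auto

text \<open>
The monomials below degree \<open>m\<close> form a basis of \<open>poly_funs (m - 1)\<close>. The existence of a finite spanning set is
recorded separately because \<open>affine_of_dim\<close> asks for it.
\<close>

lemma poly_funs_basis:
  assumes m: "m \<ge> 1"
  shows "module.subspace fscale (poly_funs (m - 1))"
    and "\<exists>\<B>. finite \<B> \<and> module.span fscale \<B> = poly_funs (m - 1)"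
    and "vector_space.dim fscale (poly_funs (m - 1)) = m"
proof -
  interpret vector_space fscale by (rule vector_space_fscale)
  define mon where "mon j = (\<lambda>x::complex. x ^ j)" for j :: nat
  define B where "B = mon ` {..<m}"
  have mon_poly: "(\<Sum>j<m. fscale (u j) (mon j)) = poly (\<Sum>j<m. monom (u j) j)" for u
    by (simp add: fun_eq_iff sum_fun_eval fscale_def mon_def poly_sum poly_monom)
  have inj: "inj_on mon {..<m}"
  proof (rule inj_onI)
    fix i j assume "mon i = mon j"
    then have "(2::complex) ^ i = 2 ^ j" by (simp add: mon_def fun_eq_iff)
    then have "norm ((2::complex) ^ i) = norm ((2::complex) ^ j)" by simp
    then show "i = j" by (simp add: norm_power)
  qed
  have fin: "finite B" and card: "card B = m" using inj by (auto simp: B_def card_image)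
  show sub: "subspace (poly_funs (m - 1))"
  proof (rule subspaceI)
    show "0 \<in> poly_funs (m - 1)" by (auto simp: poly_funs_def fun_eq_iff intro!: exI[of _ 0])
    show "f + g \<in> poly_funs (m - 1)" if fg: "f \<in> poly_funs (m - 1)" "g \<in> poly_funs (m - 1)" for f g
    proof -
      obtain p q where pq: "f = poly p" "g = poly q" "degree p \<le> m - 1" "degree q \<le> m - 1"
        using fg by (auto simp: poly_funs_def)
      then have "f + g = poly (p + q)" "degree (p + q) \<le> m - 1"
        by (auto simp: fun_eq_iff intro: degree_add_le)
      then show ?thesis by (auto simp: poly_funs_def)
    qed
    show "fscale c f \<in> poly_funs (m - 1)" if f: "f \<in> poly_funs (m - 1)" for c f
    proof -
      obtain p where p: "f = poly p" "degree p \<le> m - 1" using f by (auto simp: poly_funs_def)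
      then have "fscale c f = poly (smult c p)" "degree (smult c p) \<le> m - 1"
        using degree_smult_le[of c p] by (auto simp: fun_eq_iff fscale_def)
      then show ?thesis by (auto simp: poly_funs_def)
    qed
  qed
  have span: "span B = poly_funs (m - 1)"
  proof
    have "mon j \<in> poly_funs (m - 1)" if "j < m" for j
      using that degree_monom_le[of "1::complex" j]
      by (auto simp: poly_funs_def mon_def fun_eq_iff poly_monom intro!: exI[of _ "monom 1 j"])
    then show "span B \<subseteq> poly_funs (m - 1)" by (intro span_minimal sub) (auto simp: B_def)
    show "poly_funs (m - 1) \<subseteq> span B"
    proof
      fix v assume "v \<in> poly_funs (m - 1)"
      then obtain q where q: "v = poly q" "degree q \<le> m - 1" by (auto simp: poly_funs_def)
      have "(\<Sum>j<m. monom (coeff q j) j) = q"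
        using poly_as_sum_of_monoms'[OF q(2)] m
        by (simp add: lessThan_Suc_atMost[symmetric] del: lessThan_Suc)
      then have "v = (\<Sum>j<m. fscale (coeff q j) (mon j))" using q by (simp add: mon_poly)
      also have "\<dots> \<in> span B" by (intro span_sum span_scale span_base) (auto simp: B_def)
      finally show "v \<in> span B" .
    qed
  qed
  have indep: "independent B"
  proof (rule independent_if_scalars_zero[OF fin])
    fix u b assume s: "(\<Sum>b\<in>B. fscale (u b) b) = 0" and b: "b \<in> B"
    have "(\<Sum>b\<in>B. fscale (u b) b) = (\<Sum>j<m. fscale (u (mon j)) (mon j))"
      unfolding B_def by (rule sum.reindex_cong[OF inj]) auto
    with s have "poly (\<Sum>j<m. monom (u (mon j)) j) = 0" by (simp add: mon_poly)
    then have "(\<Sum>j<m. monom (u (mon j)) j) = 0" by (simp add: poly_eq_poly_eq_iff[symmetric] fun_eq_iff)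
    then have c: "coeff (\<Sum>j<m. monom (u (mon j)) j) i = 0" for i by simp
    obtain i where i: "i < m" "b = mon i" using b by (auto simp: B_def)
    then show "u b = 0" using c[of i] by (simp add: coeff_sum)
  qed
  show "\<exists>\<B>. finite \<B> \<and> span \<B> = poly_funs (m - 1)" using fin span by blast
  have "dim (poly_funs (m - 1)) = card B" by (rule dim_eq_card[OF _ indep]) (metis span span_span)
  then show "dim (poly_funs (m - 1)) = m" using card by simp
qed

lemma iterated_antiderivatives_eq:
  assumes m: "m \<ge> 1" and hol: "\<theta>\<^sub>0 holomorphic_on UNIV" and h: "\<forall>x. (deriv ^^ m) \<theta>\<^sub>0 x = h x"
  shows "{\<theta>. \<theta> holomorphic_on UNIV \<and> (\<forall>x. (deriv ^^ m) \<theta> x = h x)} =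
      (\<lambda>l. \<theta>\<^sub>0 + l) ` poly_funs (m - 1)" (is "?L = ?R")
proof (intro equalityI subsetI)
  fix \<theta> assume "\<theta> \<in> ?L"
  then have t: "\<theta> holomorphic_on UNIV" "\<And>x. (deriv ^^ m) \<theta> x = h x" by auto
  have "(\<lambda>x. \<theta> x - \<theta>\<^sub>0 x) holomorphic_on UNIV" by (intro holomorphic_intros t hol)
  moreover have "\<forall>x. (deriv ^^ m) (\<lambda>x. \<theta> x - \<theta>\<^sub>0 x) x = 0"
    using t h by (simp add: higher_deriv_diff[OF t(1) hol])
  ultimately have "(\<lambda>x. \<theta> x - \<theta>\<^sub>0 x) \<in> poly_funs (m - 1)"
    using entire_deriv_eq_0_iff_poly[OF _ m] by blast
  then show "\<theta> \<in> ?R" by (auto simp: fun_eq_iff intro!: image_eqI[of _ _ "\<lambda>x. \<theta> x - \<theta>\<^sub>0 x"])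
next
  fix \<theta> assume "\<theta> \<in> ?R"
  then obtain l where l: "l \<in> poly_funs (m - 1)" and \<theta>: "\<theta> = (\<lambda>x. \<theta>\<^sub>0 x + l x)"
    by (auto simp: plus_fun_def)
  have lh: "l holomorphic_on UNIV" using l by (auto simp: poly_funs_def intro!: holomorphic_intros)
  then have "\<forall>x. (deriv ^^ m) l x = 0" using entire_deriv_eq_0_iff_poly[OF _ m] l by blast
  then show "\<theta> \<in> ?L"
    using h by (auto simp: \<theta> higher_deriv_add[OF hol lh] intro!: holomorphic_intros hol lh)
qed

lemma affine_of_dim_iterated_antiderivatives:
  assumes m: "m \<ge> 1" and h: "h holomorphic_on UNIV"
  shows "affine_of_dim m {\<theta>. \<theta> holomorphic_on UNIV \<and> (\<forall>x. (deriv ^^ m) \<theta> x = h x)}"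
proof -
  obtain \<theta>\<^sub>0 where "\<theta>\<^sub>0 holomorphic_on UNIV" "(deriv ^^ m) \<theta>\<^sub>0 = h"
    using entire_iterated_antiderivative_exists[OF h] by blast
  then show ?thesis
    using poly_funs_basis[OF m] iterated_antiderivatives_eq[OF m, of \<theta>\<^sub>0 h]
    unfolding affine_of_dim_def by blast
qed

lemma higher_deriv_exp_linear:
  fixes w :: complex
  shows "(deriv ^^ m) (\<lambda>x. c * exp (w * x)) = (\<lambda>x. c * w ^ m * exp (w * x))"
proof (induction m)
  case (Suc m)
  have "deriv (\<lambda>x. c * w ^ m * exp (w * x)) x = c * w ^ Suc m * exp (w * x)" for x
    by (rule DERIV_imp_deriv) (auto intro!: derivative_eq_intros)
  then show ?case by (simp add: Suc fun_eq_iff)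
qed simp

lemma higher_deriv_power_self:
  "(deriv ^^ m) (\<lambda>x. c * x ^ m) = (\<lambda>x::complex. c * fact m)"
proof (induction m arbitrary: c)
  case (Suc m)
  have "deriv (\<lambda>x. c * x ^ Suc m) x = c * of_nat (Suc m) * x ^ m" for x
    by (rule DERIV_imp_deriv) (auto intro!: derivative_eq_intros simp del: power_Suc)
  then have "deriv (\<lambda>x. c * x ^ Suc m) = (\<lambda>x. c * of_nat (Suc m) * x ^ m)" by auto
  then show ?case using Suc[of "c * of_nat (Suc m)"]
    by (simp add: funpow_Suc_right mult.assoc del: funpow.simps power_Suc of_nat_Suc)
qed simp


section \<open>Parseval's identity in Fock space\<close>

lemma fock_norm_square:
  "pi * (fock_norm f)\<^sup>2 = (\<integral>z. (norm (f z))\<^sup>2 * exp (- (norm z)\<^sup>2) \<partial>lborel)"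
  by (simp add: fock_norm_eq)

lemma fock_norm_cmult: "fock_norm (\<lambda>x. c * f x) = norm c * fock_norm f"
proof -
  have "pi * (fock_norm (\<lambda>x. c * f x))\<^sup>2 = (\<integral>z. (norm c)\<^sup>2 * ((norm (f z))\<^sup>2 * exp (- (norm z)\<^sup>2)) \<partial>lborel)"
    by (simp add: fock_norm_square norm_mult power_mult_distrib mult.assoc)
  also have "\<dots> = pi * (norm c * fock_norm f)\<^sup>2"
    by (simp add: fock_norm_square[symmetric] power_mult_distrib)
  finally show ?thesis
    by (simp add: fock_norm_nonneg power2_eq_iff_nonneg)
qed

lemma fock_norm_sum_le:
  assumes "finite I" "\<And>i. i \<in> I \<Longrightarrow> f i \<in> exp_type"
  shows "fock_norm (\<lambda>x. \<Sum>i\<in>I. f i x) \<le> (\<Sum>i\<in>I. fock_norm (f i))"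
  using assms
proof (induction I)
  case empty
  have "(\<lambda>x. 0) = (0 :: complex \<Rightarrow> complex)" by auto
  then show ?case by (simp add: fock_norm_eq)
next
  case (insert i I)
  let ?g = "\<lambda>x. \<Sum>i\<in>I. f i x"
  have f: "f i \<in> exp_type" and g: "?g \<in> exp_type" using insert by (auto intro: exp_type_sum)
  have fg: "f i + ?g = (\<lambda>x. f i x + ?g x)" by (simp add: plus_fun_def)
  have "fock_norm (f i + ?g) \<le> fock_norm (f i) + fock_norm ?g"
    by (rule fock_norm_triangle) (auto simp: fg intro!: exp_type_imp_fock exp_type_add f g)
  then show ?case using insert by (simp add: fg)
qed

lemma fock_space_borel_measurable:
  "f \<in> fock_space \<Longrightarrow> f \<in> borel_measurable borel"
  by (auto simp: fock_space_def intro!: borel_measurable_continuous_onI holomorphic_on_imp_continuous_on)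

lemma integrable_gaussian_moment:
  "integrable lborel (\<lambda>z::complex. norm z ^ (2 * n) * exp (- (norm z)\<^sup>2))"
proof -
  have "(\<lambda>z. z ^ n) \<in> fock_space" by (intro exp_type_imp_fock exp_type_intros)
  then show ?thesis by (simp add: fock_space_def norm_power power_mult power_mult_distrib mult.commute[of 2])
qed

lemma integral_exhaust_balls:
  fixes g :: "complex \<Rightarrow> real"
  assumes g: "integrable lborel g"
  shows "(\<lambda>k. \<integral>z. g z * indicator (cball 0 (real k + 1)) z \<partial>lborel) \<longlonglongrightarrow> (\<integral>z. g z \<partial>lborel)"
proof (rule integral_dominated_convergence[where w = "\<lambda>z. norm (g z)"])
  have [measurable]: "g \<in> borel_measurable borel"
    using g by (simp add: borel_measurable_integrable)
  have [measurable]: "cball (0::complex) r \<in> sets borel" for r by simp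
  show "g \<in> borel_measurable lborel" "(\<lambda>z. g z * indicator (cball 0 (real k + 1)) z) \<in> borel_measurable lborel" for k
    by measurable
  show "AE z in lborel. (\<lambda>k. g z * indicator (cball 0 (real k + 1)) z) \<longlonglongrightarrow> g z"
  proof (rule AE_I2)
    fix z :: complex
    obtain k0 where "norm z \<le> real k0" using real_arch_simple by blast
    then have "eventually (\<lambda>k. g z * indicator (cball 0 (real k + 1)) z = g z) sequentially"
      by (intro eventually_sequentiallyI[of k0]) auto
    then show "(\<lambda>k. g z * indicator (cball 0 (real k + 1)) z) \<longlonglongrightarrow> g z"
      by (rule tendsto_eventually)
  qed
  show "AE z in lborel. norm (g z * indicator (cball 0 (real k + 1)) z) \<le> norm (g z)" for k
    by (auto simp: indicator_def)
qed (use g in simp)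

text \<open>
The identity holds for the Gaussian restricted to each disc of radius \<open>k + 1\<close>. Moments and integrals
increase to their full values as \<open>k\<close> grows; comparing partial sums with the full integral, and the
restricted integrals with the full series, gives the two inequalities.
\<close>

lemma parseval_fock:
  assumes f: "f \<in> fock_space" and sums: "\<And>z. (\<lambda>n. a n * z ^ n) sums f z"
  shows "(\<lambda>n. (norm (a n))\<^sup>2 * (\<integral>z. norm z ^ (2 * n) * exp (- (norm (z::complex))\<^sup>2) \<partial>lborel)) sums
      (pi * (fock_norm f)\<^sup>2)"
proof -
  define I where "I = pi * (fock_norm f)\<^sup>2"
  define w where "w k z = exp (- (norm z)\<^sup>2) * indicator (cball 0 (real k + 1)) z" for k and z :: complex
  define c where "c n = (\<integral>z. norm z ^ (2 * n) * exp (- (norm (z::complex))\<^sup>2) \<partial>lborel)" for n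
  define ck where "ck k n = (\<integral>z. norm z ^ (2 * n) * w k z \<partial>lborel)" for k n
  define Ik where "Ik k = (\<integral>z. (norm (f z))\<^sup>2 * w k z \<partial>lborel)" for k
  have [measurable]: "w k \<in> borel_measurable borel" for k
  proof -
    have [measurable]: "cball (0::complex) r \<in> sets borel" for r by simp
    show ?thesis unfolding w_def by measurable
  qed
  have w_nonneg: "w k z \<ge> 0" for k z by (simp add: w_def)
  have fint: "integrable lborel (\<lambda>z. (norm (f z))\<^sup>2 * exp (- (norm z)\<^sup>2))"
    using f by (simp add: fock_space_def)
  have int_ball: "integrable lborel (\<lambda>z. g z * indicator (cball 0 (real k + 1)) z)"
    if "integrable lborel g" for g :: "complex \<Rightarrow> real" and k
    using integrable_mult_indicator[OF _ that, of "cball 0 (real k + 1)"] by (simp add: mult.commute)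
  have P: "(\<lambda>n. (norm (a n))\<^sup>2 * ck k n) sums Ik k" for k
    unfolding ck_def Ik_def
  proof (rule parseval_radial_entire[where R = "real k + 1"])
    have "w k = (\<lambda>z. exp (- (norm z)\<^sup>2) * indicator (cball 0 (real k + 1)) z)"
      by (simp add: w_def fun_eq_iff)
    then show "integrable lborel (w k)"
      using int_ball[OF integrable_gaussian_moment[of 0], of k] by simp
    show "norm z > real k + 1 \<Longrightarrow> w k z = 0" for z by (simp add: w_def)
    show "norm c = 1 \<Longrightarrow> w k (c * z) = w k z" for c z by (simp add: w_def norm_mult indicator_def)
  qed (use sums w_nonneg in auto)
  have ck_lim: "(\<lambda>k. ck k n) \<longlonglongrightarrow> c n" for n
    using integral_exhaust_balls[OF integrable_gaussian_moment[of n]]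
    by (simp add: ck_def c_def w_def mult.assoc)
  have Ik_lim: "Ik \<longlonglongrightarrow> I"
    using integral_exhaust_balls[OF fint] by (simp add: Ik_def[abs_def] I_def w_def mult.assoc fock_norm_square)
  have ck_nonneg: "ck k n \<ge> 0" for k n
    unfolding ck_def by (rule Bochner_Integration.integral_nonneg) (simp add: w_nonneg)
  have ck_le: "ck k n \<le> c n" for k n
    unfolding ck_def c_def w_def mult.assoc[symmetric]
    by (intro integral_mono int_ball integrable_gaussian_moment) (auto simp: indicator_def)
  have Ik_le: "Ik k \<le> I" for k
    unfolding Ik_def I_def w_def mult.assoc[symmetric] fock_norm_square
    by (intro integral_mono int_ball fint) (auto simp: indicator_def)
  have c_nonneg: "c n \<ge> 0" for n by (rule order_trans[OF ck_nonneg ck_le[of 0]])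
  \<comment> \<open>A finite partial sum is bounded for each disc, so the limit in \<open>k\<close> can be taken term by term.\<close>
  have part_le: "(\<Sum>n<N. (norm (a n))\<^sup>2 * c n) \<le> I" for N
  proof (rule LIMSEQ_le_const2)
    show "(\<lambda>k. \<Sum>n<N. (norm (a n))\<^sup>2 * ck k n) \<longlonglongrightarrow> (\<Sum>n<N. (norm (a n))\<^sup>2 * c n)"
      by (intro tendsto_intros ck_lim)
    have "(\<Sum>n<N. (norm (a n))\<^sup>2 * ck k n) \<le> I" for k
    proof -
      have "(\<Sum>n<N. (norm (a n))\<^sup>2 * ck k n) \<le> (\<Sum>n. (norm (a n))\<^sup>2 * ck k n)"
        by (rule sum_le_suminf) (use P ck_nonneg in \<open>auto simp: sums_iff\<close>)
      also have "\<dots> = Ik k" using P[of k] by (simp add: sums_iff)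
      finally show ?thesis using Ik_le[of k] by simp
    qed
    then show "\<exists>K. \<forall>k\<ge>K. (\<Sum>n<N. (norm (a n))\<^sup>2 * ck k n) \<le> I" by blast
  qed
  have summ: "summable (\<lambda>n. (norm (a n))\<^sup>2 * c n)"
    by (rule summableI_nonneg_bounded[OF _ part_le]) (simp add: c_nonneg)
  have "(\<Sum>n. (norm (a n))\<^sup>2 * c n) \<le> I" by (rule suminf_le_const[OF summ part_le])
  moreover have "I \<le> (\<Sum>n. (norm (a n))\<^sup>2 * c n)"
  proof (rule LIMSEQ_le_const2[OF Ik_lim])
    have "Ik k \<le> (\<Sum>n. (norm (a n))\<^sup>2 * c n)" for k
      by (rule sums_le[OF _ P[of k] summable_sums[OF summ]]) (simp add: mult_left_mono ck_le)
    then show "\<exists>K. \<forall>k\<ge>K. Ik k \<le> (\<Sum>n. (norm (a n))\<^sup>2 * c n)" by blast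
  qed
  ultimately have "(\<Sum>n. (norm (a n))\<^sup>2 * c n) = I" by simp
  then show ?thesis using summ unfolding c_def[symmetric] I_def[symmetric] by (simp add: sums_iff)
qed

text \<open>
The error has the Taylor coefficients of \<open>f\<close> with the first \<open>N\<close> removed, so by Parseval its square norm is
a tail of the convergent series for \<open>f\<close>.
\<close>

lemma fock_taylor_polynomials_converge:
  assumes f: "f \<in> fock_space" and sums: "\<And>z. (\<lambda>n. a n * z ^ n) sums f z"
  shows "(\<lambda>N. fock_norm (f - (\<lambda>z. \<Sum>n<N. a n * z ^ n))) \<longlonglongrightarrow> 0"
proof -
  define c where "c n = (\<integral>z. norm z ^ (2 * n) * exp (- (norm (z::complex))\<^sup>2) \<partial>lborel)" for n
  define I where "I = pi * (fock_norm f)\<^sup>2"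
  define S where "S N = (\<lambda>z. \<Sum>n<N. a n * z ^ n)" for N
  have P: "(\<lambda>n. (norm (a n))\<^sup>2 * c n) sums I"
    using parseval_fock[OF f sums] by (simp add: c_def I_def)
  have "pi * (fock_norm (f - S N))\<^sup>2 = I - (\<Sum>n<N. (norm (a n))\<^sup>2 * c n)" for N
  proof -
    define a' where "a' n = a n - (if n \<in> {..<N} then a n else 0)" for n
    have "S N \<in> fock_space" unfolding S_def by (intro exp_type_imp_fock exp_type_intros)
    then have D: "f - S N \<in> fock_space" by (rule fock_space_diff[OF f])
    have "(\<lambda>n. a' n * z ^ n) sums (f - S N) z" for z
    proof -
      have "(\<lambda>n. a n * z ^ n - (if n \<in> {..<N} then a n * z ^ n else 0)) sums (f z - S N z)"
        unfolding S_def by (intro sums_diff sums sums_If_finite_set) simp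
      moreover have "(\<lambda>n. a' n * z ^ n) = (\<lambda>n. a n * z ^ n - (if n \<in> {..<N} then a n * z ^ n else 0))"
        by (auto simp: a'_def fun_eq_iff)
      ultimately show ?thesis by simp
    qed
    from parseval_fock[OF D this]
    have A: "(\<lambda>n. (norm (a' n))\<^sup>2 * c n) sums (pi * (fock_norm (f - S N))\<^sup>2)"
      by (simp only: c_def)
    have B: "(\<lambda>n. (norm (a n))\<^sup>2 * c n - (if n \<in> {..<N} then (norm (a n))\<^sup>2 * c n else 0)) sums
        (I - (\<Sum>n<N. (norm (a n))\<^sup>2 * c n))"
      by (intro sums_diff P sums_If_finite_set) simp
    have "(\<lambda>n. (norm (a' n))\<^sup>2 * c n) =
        (\<lambda>n. (norm (a n))\<^sup>2 * c n - (if n \<in> {..<N} then (norm (a n))\<^sup>2 * c n else 0))"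
      by (auto simp: a'_def fun_eq_iff)
    with A B show ?thesis by (simp only: sums_unique2)
  qed
  note eq0 = this
  have eq: "fock_norm (f - S N) = sqrt ((I - (\<Sum>n<N. (norm (a n))\<^sup>2 * c n)) / pi)" for N
    by (simp add: fock_norm_nonneg flip: eq0)
  have "(\<lambda>N. sqrt ((I - (\<Sum>n<N. (norm (a n))\<^sup>2 * c n)) / pi)) \<longlonglongrightarrow> sqrt ((I - I) / pi)"
    using P by (intro tendsto_intros) (auto simp: sums_def)
  then show ?thesis by (simp add: eq S_def[symmetric])
qed

text \<open>
Parseval on the unit disc about \<open>y\<close> bounds a single Taylor coefficient at \<open>y\<close> by the square integral of \<open>f\<close>
over that disc. There the Gaussian is at least \<open>exp (- (norm y + 1)\<^sup>2)\<close>, so this integral is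
controlled by the Fock norm.
\<close>

lemma fock_higher_deriv_bounded:
  "\<exists>K\<ge>0. \<forall>f\<in>fock_space. norm ((deriv ^^ j) f y) \<le> K * fock_norm f"
proof -
  define w where "w = (indicator (cball 0 1) :: complex \<Rightarrow> real)"
  define c where "c n = (\<integral>z. norm z ^ (2 * n) * w z \<partial>lborel)" for n
  define E where "E = exp ((norm y + 1)\<^sup>2)"
  have [measurable]: "w \<in> borel_measurable borel" unfolding w_def by (rule borel_measurable_indicator) simp
  have wint: "integrable lborel w"
    unfolding w_def
  proof (rule integrable_real_indicator)
    show "emeasure lborel (cball (0::complex) 1) < \<infinity>" by (rule emeasure_bounded_finite) simp
  qed simp
  have c_nonneg: "c n \<ge> 0" for n unfolding c_def w_def by (rule Bochner_Integration.integral_nonneg) simp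
  have c_pos: "c j > 0"
  proof -
    \<comment> \<open>On this small disc \<open>norm z\<close> lies between \<open>1/2\<close> and \<open>1\<close>, so the moment is positive.\<close>
    let ?B = "ball (3/4::complex) (1/4)"
    have meas: "emeasure lborel ?B < \<infinity>" by (rule emeasure_bounded_finite) simp
    have "0 < (1/2) ^ (2 * j) * measure lborel ?B"
      using content_ball_pos[of "1/4" "3/4 :: complex"] by simp
    also have "\<dots> = (\<integral>z. (1/2) ^ (2 * j) * indicator ?B z \<partial>lborel)" by simp
    also have "\<dots> \<le> c j"
      unfolding c_def
    proof (rule integral_mono)
      show "integrable lborel (\<lambda>z. (1/2) ^ (2 * j) * indicator ?B z :: real)"
        using meas by (intro integrable_mult_right integrable_real_indicator) auto
      show "integrable lborel (\<lambda>z. norm z ^ (2 * j) * w z)"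
      proof (rule Bochner_Integration.integrable_bound[OF wint])
        show "AE z in lborel. norm (norm z ^ (2 * j) * w z) \<le> norm (w z)"
          by (auto simp: w_def indicator_def power_le_one)
      qed simp
      fix z :: complex
      show "(1/2) ^ (2 * j) * indicator ?B z \<le> norm z ^ (2 * j) * w z"
      proof (cases "z \<in> ?B")
        case True
        have "norm z \<ge> 1/2"
          using True norm_triangle_ineq2[of "3/4" "3/4 - z"] by (simp add: dist_norm)
        moreover have "norm z \<le> 1"
          using True norm_triangle_ineq2[of z "3/4"] by (simp add: dist_norm norm_minus_commute)
        ultimately show ?thesis using True by (auto simp: w_def intro!: power_mono)
      qed (simp add: w_def)
    qed
    finally show ?thesis .
  qed
  define K where "K = fact j * sqrt (E * pi / c j)"
  have "norm ((deriv ^^ j) f y) \<le> K * fock_norm f" if f: "f \<in> fock_space" for f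
  proof -
    have hol: "f holomorphic_on UNIV" using f by (simp add: fock_space_def)
    note [measurable] = fock_space_borel_measurable[OF f]
    define a where "a n = (deriv ^^ n) f y / fact n" for n
    have sums: "(\<lambda>n. a n * z ^ n) sums f (y + z)" for z
      using holomorphic_power_series[of f y "norm z + 1" "y + z"] hol
      by (auto simp: a_def dist_norm intro: holomorphic_on_subset)
    have P: "(\<lambda>n. (norm (a n))\<^sup>2 * c n) sums (\<integral>z. (norm (f (y + z)))\<^sup>2 * w z \<partial>lborel)"
      unfolding c_def
    proof (rule parseval_radial_entire[where R = 1])
      show "norm u = 1 \<Longrightarrow> w (u * z) = w z" for u z by (simp add: w_def norm_mult indicator_def)
      show "norm z > 1 \<Longrightarrow> w z = 0" "w z \<ge> 0" for z by (simp_all add: w_def)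
    qed (use sums wint in simp_all)
    let ?g = "\<lambda>z. (norm (f z))\<^sup>2 * exp (- (norm z)\<^sup>2)"
    have "(norm (a j))\<^sup>2 * c j \<le> (\<Sum>n. (norm (a n))\<^sup>2 * c n)"
      using sum_le_suminf[of "\<lambda>n. (norm (a n))\<^sup>2 * c n" "{j}"] P c_nonneg by (simp add: sums_iff)
    also have "\<dots> = (\<integral>z. (norm (f (y + z)))\<^sup>2 * w z \<partial>lborel)" using P by (simp add: sums_iff)
    also have "\<dots> \<le> (\<integral>z. E * ?g (y + z) \<partial>lborel)"
    proof (rule integral_mono')
      have "integrable (distr lborel borel ((+) y)) ?g"
        using f by (simp add: lborel_distr_plus fock_space_def)
      then have "integrable lborel (\<lambda>z. ?g (y + z))"
        by (subst (asm) integrable_distr_eq) auto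
      then show "integrable lborel (\<lambda>z. E * ?g (y + z))" by (rule integrable_mult_right)
      show "0 \<le> E * ?g (y + z)" for z by (simp add: E_def)
      fix z :: complex
      show "(norm (f (y + z)))\<^sup>2 * w z \<le> E * ?g (y + z)"
      proof (cases "norm z \<le> 1")
        case True
        have "(norm (y + z))\<^sup>2 \<le> (norm y + 1)\<^sup>2"
          using True norm_triangle_ineq[of y z] by (intro power_mono) auto
        then have "1 \<le> E * exp (- (norm (y + z))\<^sup>2)" by (simp add: E_def exp_add[symmetric])
        then have "(norm (f (y + z)))\<^sup>2 * 1 \<le> (norm (f (y + z)))\<^sup>2 * (E * exp (- (norm (y + z))\<^sup>2))"
          by (rule mult_left_mono) simp
        then show ?thesis using True by (simp add: w_def mult_ac)
      qed (simp add: w_def E_def)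
    qed
    also have "\<dots> = E * (\<integral>z. ?g (y + z) \<partial>lborel)" by simp
    also have "(\<integral>z. ?g (y + z) \<partial>lborel) = (\<integral>z. ?g z \<partial>distr lborel borel ((+) y))"
      by (subst integral_distr) auto
    also have "\<dots> = pi * (fock_norm f)\<^sup>2" by (simp add: lborel_distr_plus fock_norm_square)
    finally have "(norm (a j))\<^sup>2 \<le> E * pi / c j * (fock_norm f)\<^sup>2"
      using c_pos by (simp add: field_simps)
    then have "norm (a j) \<le> sqrt (E * pi / c j * (fock_norm f)\<^sup>2)"
      by (rule real_le_rsqrt)
    also have "\<dots> = sqrt (E * pi / c j) * fock_norm f"
      by (subst real_sqrt_mult) (simp add: fock_norm_nonneg)
    finally show ?thesis
      by (simp add: a_def K_def norm_divide field_simps)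
  qed
  moreover have "K \<ge> 0" using c_pos by (simp add: K_def E_def)
  ultimately show ?thesis by (intro exI[of _ K] conjI ballI)
qed


section \<open>Domain and values of the operator\<close>

text \<open>
Differentiation lowers the exponent of \<open>w - y\<close> by one and leaves an entire cofactor, so induction on \<open>j\<close>
works for all cofactors at once.
\<close>

lemma higher_deriv_eq_0_if_multiple_zero:
  assumes "H holomorphic_on UNIV" "j < m"
  shows "(deriv ^^ j) (\<lambda>w. (w - y) ^ m * H w) y = 0"
  using assms
proof (induction j arbitrary: m H)
  case (Suc j)
  then obtain n where m: "m = Suc n" "j < n" by (cases m) auto
  have "deriv (\<lambda>w. (w - y) ^ m * H w) = (\<lambda>w. (w - y) ^ n * (of_nat m * H w + (w - y) * deriv H w))"
  proof
    fix w
    have H': "(H has_field_derivative deriv H w) (at w)" by (rule holomorphic_derivI[OF Suc.prems(1)]) auto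
    have P: "((\<lambda>w. (w - y) ^ m) has_field_derivative of_nat m * (w - y) ^ n) (at w)"
      unfolding m(1)
      by (rule DERIV_cong[OF DERIV_power[OF DERIV_diff[OF DERIV_ident DERIV_const]]]) simp
    have "((\<lambda>w. (w - y) ^ m * H w) has_field_derivative
        (w - y) ^ n * (of_nat m * H w + (w - y) * deriv H w)) (at w)"
      by (rule DERIV_cong[OF DERIV_mult[OF P H']]) (simp add: m(1) algebra_simps)
    then show "deriv (\<lambda>w. (w - y) ^ m * H w) w = (w - y) ^ n * (of_nat m * H w + (w - y) * deriv H w)"
      by (rule DERIV_imp_deriv)
  qed
  moreover have "(\<lambda>w. of_nat m * H w + (w - y) * deriv H w) holomorphic_on UNIV"
    by (intro holomorphic_intros holomorphic_deriv Suc.prems) auto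
  ultimately show ?case using Suc.IH[of "\<lambda>w. of_nat m * H w + (w - y) * deriv H w" n] m
    by (simp add: funpow_Suc_right del: funpow.simps)
qed simp

text \<open>
Used to divide an identity by a factor with a single zero.
\<close>

lemma continuous_eq_everywhere:
  fixes f g :: "complex \<Rightarrow> complex"
  assumes "continuous_on UNIV f" "continuous_on UNIV g" and eq: "\<And>x. x \<noteq> y \<Longrightarrow> f x = g x"
  shows "f x = g x"
proof (cases "x = y")
  case True
  have "isCont f y" "isCont g y" using assms by (auto simp: continuous_on_eq_continuous_at)
  then have "(f \<longlongrightarrow> f y) (at y)" "(g \<longlongrightarrow> g y) (at y)" by (auto simp: isCont_def)
  moreover have "eventually (\<lambda>x. f x = g x) (at y)" using eq by (auto simp: eventually_at_filter)
  ultimately have "(f \<longlongrightarrow> g y) (at y)" by (simp add: tendsto_cong)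
  then show ?thesis using \<open>(f \<longlongrightarrow> f y) (at y)\<close> True tendsto_unique[of "at y" f] by simp
qed (rule eq)

text \<open>
Cancelling the common factor \<open>(a * A * x + a * B + b) ^ m\<close> leaves the equation \<open>(deriv ^^ m) g = k\<close> with \<open>k\<close>
of exponential type; any entire solution is again of exponential type, hence in Fock space.
\<close>

lemma smax_dom_of_factor:
  assumes h: "h \<in> exp_type" and f: "\<And>w. f w = (a * w + b) ^ m * h w"
  shows "f \<in> smax_dom m (\<lambda>x. C * exp (D * x)) (\<lambda>x. A * x + B) (\<lambda>x. (a * A * x + a * B + b) ^ m)"
proof -
  have "f = (\<lambda>w. (a * w + b) ^ m * h w)" using f by auto
  then have "f \<in> fock_space" by (auto intro!: exp_type_imp_fock exp_type_intros h)
  define k where "k x = C * exp (D * x) * h (A * x + B)" for x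
  have k: "k \<in> exp_type" unfolding k_def by (intro exp_type_intros exp_type_affine h)
  obtain g where g: "g holomorphic_on UNIV" "(deriv ^^ m) g = k"
    using entire_iterated_antiderivative_exists[OF exp_type_holomorphic[OF k]] by blast
  have "g \<in> fock_space"
    using g k by (auto intro!: exp_type_imp_fock exp_type_iterated_antiderivative[of g m])
  moreover have "C * exp (D * x) * f (A * x + B) = (a * A * x + a * B + b) ^ m * (deriv ^^ m) g x" for x
    by (simp add: g f k_def algebra_simps)
  ultimately show ?thesis using \<open>f \<in> fock_space\<close> unfolding smax_dom_def by blast
qed

text \<open>
Solve the defining equation for \<open>f\<close> at \<open>w = A * x + B\<close>; the exponential in the denominator has no zeros,
so the cofactor is entire.
\<close>

lemma smax_dom_imp_factor:
  assumes f: "f \<in> smax_dom m (\<lambda>x. C * exp (D * x)) (\<lambda>x. A * x + B) (\<lambda>x. (a * A * x + a * B + b) ^ m)"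
    and nz: "a \<noteq> 0" "A \<noteq> 0" "C \<noteq> 0"
  obtains H where "H holomorphic_on UNIV" "\<forall>w. f w = (w - (- b / a)) ^ m * H w"
proof -
  obtain g where g: "g \<in> fock_space"
    and eq: "\<And>x. C * exp (D * x) * f (A * x + B) = (a * A * x + a * B + b) ^ m * (deriv ^^ m) g x"
    using f by (auto simp: smax_dom_def)
  define H where "H w = a ^ m * (deriv ^^ m) g ((w - B) / A) / (C * exp (D * ((w - B) / A)))" for w
  have gm: "(deriv ^^ m) g holomorphic_on UNIV"
    using g by (intro holomorphic_higher_deriv) (auto simp: fock_space_def)
  have "((deriv ^^ m) g \<circ> (\<lambda>w. (w - B) / A)) holomorphic_on UNIV"
    by (rule holomorphic_on_compose_gen[OF _ gm]) (use nz in \<open>auto intro!: holomorphic_intros\<close>)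
  then have g': "(\<lambda>w. (deriv ^^ m) g ((w - B) / A)) holomorphic_on UNIV" by (simp add: o_def)
  have "H holomorphic_on UNIV"
    unfolding H_def using nz
    by (intro holomorphic_on_divide[OF holomorphic_on_mult[OF holomorphic_on_const g']] holomorphic_intros) auto
  moreover have "f w = (w - (- b / a)) ^ m * H w" for w
  proof -
    define x where "x = (w - B) / A"
    have w: "A * x + B = w" using nz by (simp add: x_def)
    have "a * A * x + a * B + b = a * (w - (- b / a))"
      using nz by (simp add: w[symmetric] field_simps)
    then have "C * exp (D * x) * f w = a ^ m * (w - (- b / a)) ^ m * (deriv ^^ m) g x"
      using eq[of x] by (simp add: w power_mult_distrib)
    then show ?thesis using nz by (simp add: H_def x_def[symmetric] field_simps)
  qed
  ultimately show ?thesis using that by blast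
qed

lemma kern_k_mem_smax_dom:
  assumes "k \<ge> m"
  shows "kern_k k z a b \<in> smax_dom m (\<lambda>x. C * exp (D * x)) (\<lambda>x. A * x + B)
    (\<lambda>x. (a * A * x + a * B + b) ^ m)"
proof (rule smax_dom_of_factor)
  show "(\<lambda>w. (a * w + b) ^ (k - m) * exp (cnj z * w)) \<in> exp_type" by (intro exp_type_intros)
  show "kern_k k z a b w = (a * w + b) ^ m * ((a * w + b) ^ (k - m) * exp (cnj z * w))" for w
    using assms by (simp add: kern_k_def mult.assoc[symmetric] power_add[symmetric] mult.commute[of w])
qed

text \<open>
After division by \<open>(w - y) ^ k\<close>, the kernel function has the nonzero value \<open>a ^ k * exp (y * cnj z)\<close> at
\<open>y\<close>, whereas the factorization of domain elements leaves the factor \<open>(w - y) ^ (m - k)\<close>, which vanishes there.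
\<close>

lemma kern_k_notin_smax_dom:
  assumes k: "k < m" and nz: "a \<noteq> 0" "A \<noteq> 0" "C \<noteq> 0"
  shows "kern_k k z a b \<notin> smax_dom m (\<lambda>x. C * exp (D * x)) (\<lambda>x. A * x + B)
    (\<lambda>x. (a * A * x + a * B + b) ^ m)"
proof
  assume "kern_k k z a b \<in> smax_dom m (\<lambda>x. C * exp (D * x)) (\<lambda>x. A * x + B)
    (\<lambda>x. (a * A * x + a * B + b) ^ m)"
  then obtain H where H: "H holomorphic_on UNIV" "\<forall>w. kern_k k z a b w = (w - (- b / a)) ^ m * H w"
    using nz by (rule smax_dom_imp_factor)
  define y where "y = - b / a"
  have lin: "a * w + b = a * (w - y)" for w using nz by (simp add: y_def field_simps)
  have "a ^ k * exp (y * cnj z) = (y - y) ^ (m - k) * H y"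
  proof (rule continuous_eq_everywhere[where y = y and x = y and f = "\<lambda>w. a ^ k * exp (w * cnj z)"
        and g = "\<lambda>w. (w - y) ^ (m - k) * H w"])
    show "continuous_on UNIV (\<lambda>w. a ^ k * exp (w * cnj z))" by (intro continuous_intros)
    show "continuous_on UNIV (\<lambda>w. (w - y) ^ (m - k) * H w)"
      by (intro continuous_intros holomorphic_on_imp_continuous_on H)
    fix w assume w: "w \<noteq> y"
    have "(w - y) ^ k * (a ^ k * exp (w * cnj z)) = kern_k k z a b w"
      by (simp add: kern_k_def lin power_mult_distrib)
    also have "\<dots> = (w - y) ^ m * H w" using H(2) by (simp add: y_def)
    also have "(w - y) ^ m = (w - y) ^ k * (w - y) ^ (m - k)" using k by (simp flip: power_add)
    finally have "(w - y) ^ k * (a ^ k * exp (w * cnj z)) = (w - y) ^ k * ((w - y) ^ (m - k) * H w)"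
      by (simp only: mult.assoc)
    then show "a ^ k * exp (w * cnj z) = (w - y) ^ (m - k) * H w" using w by simp
  qed
  then show False using k nz by (simp add: power_0_left)
qed

text \<open>
Inserting the kernel function into the equation produces the factor \<open>\<Phi>\<close> on both sides. It can be
cancelled away from its only zero, and at that point by continuity. Conversely, every entire solution of
the reduced equation is of exponential type, so membership in Fock space is automatic.
\<close>

lemma smax_kern_k:
  assumes k: "k \<ge> m" and nz: "a \<noteq> 0" "A \<noteq> 0" "C \<noteq> 0"
  shows "smax m (\<lambda>x. C * exp (D * x)) (\<lambda>x. A * x + B) (\<lambda>x. (a * A * x + a * B + b) ^ m) (kern_k k z a b) =
      {\<theta>. \<theta> holomorphic_on UNIV \<and>
        (\<forall>x. (deriv ^^ m) \<theta> x = C * exp (B * cnj z) * (a * A * x + a * B + b) ^ (k - m) *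
          kern (cnj A * z + cnj D) x)}"
proof -
  define h where "h x = C * exp (B * cnj z) * (a * A * x + a * B + b) ^ (k - m) *
    kern (cnj A * z + cnj D) x" for x
  have h_eq: "h = (\<lambda>x. C * exp (B * cnj z) * (a * A * x + a * B + b) ^ (k - m) *
      exp ((A * cnj z + D) * x))"
    by (simp add: h_def kern_def fun_eq_iff mult.commute)
  have h: "h \<in> exp_type" unfolding h_eq by (intro exp_type_intros)
  have lhs: "C * exp (D * x) * kern_k k z a b (A * x + B) = (a * A * x + a * B + b) ^ m * h x" for x
  proof -
    have "exp (D * x) * exp ((A * x + B) * cnj z) = exp (B * cnj z) * exp ((A * cnj z + D) * x)"
      by (simp add: exp_add[symmetric] algebra_simps)
    moreover have "(a * (A * x + B) + b) ^ k =
        (a * A * x + a * B + b) ^ m * (a * A * x + a * B + b) ^ (k - m)"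
      using k by (simp add: power_add[symmetric] algebra_simps)
    ultimately show ?thesis by (simp add: h_eq kern_k_def mult_ac)
  qed
  have "\<theta> \<in> smax m (\<lambda>x. C * exp (D * x)) (\<lambda>x. A * x + B) (\<lambda>x. (a * A * x + a * B + b) ^ m) (kern_k k z a b)
      \<longleftrightarrow> \<theta> holomorphic_on UNIV \<and> (\<forall>x. (deriv ^^ m) \<theta> x = h x)" for \<theta>
  proof
    assume "\<theta> \<in> smax m (\<lambda>x. C * exp (D * x)) (\<lambda>x. A * x + B) (\<lambda>x. (a * A * x + a * B + b) ^ m) (kern_k k z a b)"
    then have t: "\<theta> holomorphic_on UNIV"
      and eq: "\<And>x. (a * A * x + a * B + b) ^ m * h x = (a * A * x + a * B + b) ^ m * (deriv ^^ m) \<theta> x"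
      by (auto simp: smax_def fock_space_def lhs)
    have "(deriv ^^ m) \<theta> x = h x" for x
    proof (rule continuous_eq_everywhere[where f = "(deriv ^^ m) \<theta>" and g = h
          and y = "- (a * B + b) / (a * A)"])
      show "continuous_on UNIV ((deriv ^^ m) \<theta>)"
        by (intro holomorphic_on_imp_continuous_on holomorphic_higher_deriv t) auto
      show "continuous_on UNIV h" by (intro holomorphic_on_imp_continuous_on exp_type_holomorphic h)
      fix x assume x: "x \<noteq> - (a * B + b) / (a * A)"
      have "a * A * x + a * B + b \<noteq> 0"
      proof
        assume "a * A * x + a * B + b = 0"
        then have "x * (a * A) = - (a * B + b)" by (simp add: eq_neg_iff_add_eq_0 algebra_simps)
        then have "x = - (a * B + b) / (a * A)" using nz by (simp only: eq_divide_eq) simp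
        with x show False by contradiction
      qed
      then show "(deriv ^^ m) \<theta> x = h x" using eq[of x] by simp
    qed
    with t show "\<theta> holomorphic_on UNIV \<and> (\<forall>x. (deriv ^^ m) \<theta> x = h x)" by blast
  next
    assume t: "\<theta> holomorphic_on UNIV \<and> (\<forall>x. (deriv ^^ m) \<theta> x = h x)"
    then have "(deriv ^^ m) \<theta> = h" by auto
    then have "\<theta> \<in> fock_space"
      using t h by (auto intro!: exp_type_imp_fock exp_type_iterated_antiderivative[of \<theta> m])
    with t show "\<theta> \<in> smax m (\<lambda>x. C * exp (D * x)) (\<lambda>x. A * x + B)
        (\<lambda>x. (a * A * x + a * B + b) ^ m) (kern_k k z a b)"
      by (simp add: smax_def lhs)
  qed
  then show ?thesis unfolding h_def by blast
qed


section \<open>Closure of the domain\<close>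

text \<open>
The approximant is a Taylor polynomial of \<open>f\<close> at \<open>0\<close> without the part of degree below \<open>m\<close> of its expansion
about \<open>y\<close>. The coefficients of that part are, up to factorials, derivatives at \<open>y\<close> of the approximation error, because those of
\<open>f\<close> vanish. Hence the correction costs at most \<open>L - 1\<close> times the error, with \<open>L\<close> independent of the
chosen Taylor polynomial.
\<close>

lemma fock_zeros_approximation:
  assumes m: "m \<ge> 1" and f: "f \<in> fock_zeros m y" and "\<epsilon> > 0"
  obtains h where "h \<in> exp_type" "fock_dist f (\<lambda>x. (x - y) ^ m * h x) < \<epsilon>"
proof -
  have ff: "f \<in> fock_space" and fz: "\<And>j. j < m \<Longrightarrow> (deriv ^^ j) f y = 0"
    using f by (auto simp: fock_zeros_def)
  have fh: "f holomorphic_on UNIV" using ff by (simp add: fock_space_def)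
  define a where "a n = (deriv ^^ n) f 0 / fact n" for n
  have sums: "(\<lambda>n. a n * z ^ n) sums f z" for z
    using holomorphic_power_series[of f 0 "norm z + 1" z] fh
    by (auto simp: a_def intro: holomorphic_on_subset)
  define S where "S N = (\<lambda>z. \<Sum>n<N. a n * z ^ n)" for N
  have S: "S N \<in> exp_type" for N unfolding S_def by (intro exp_type_intros)
  obtain K where K: "\<And>j. K j \<ge> 0"
    "\<And>j g. g \<in> fock_space \<Longrightarrow> norm ((deriv ^^ j) g y) \<le> K j * fock_norm g"
    using fock_higher_deriv_bounded[where y = y] by metis
  define L where "L = 1 + (\<Sum>j<m. K j / fact j * fock_norm (\<lambda>x. (x - y) ^ j))"
  have L: "L > 0"
    unfolding L_def by (intro add_pos_nonneg sum_nonneg) (auto simp: K fock_norm_nonneg)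
  have "eventually (\<lambda>N. fock_norm (f - S N) < \<epsilon> / L) sequentially"
    using fock_taylor_polynomials_converge[OF ff sums] L \<open>\<epsilon> > 0\<close>
    unfolding S_def by (intro order_tendstoD) auto
  then obtain N where N: "fock_norm (f - S N) < \<epsilon> / L"
    by (auto simp: eventually_sequentially)
  define d where "d j = (deriv ^^ j) (S N) y / fact j" for j
  \<comment> \<open>Adding \<open>m\<close> to \<open>N\<close> makes the expansion about \<open>y\<close> long enough to be cut at degree \<open>m\<close>.\<close>
  define M where "M = N + m"
  have Sh: "S N holomorphic_on UNIV" by (rule exp_type_holomorphic[OF S])
  have "S N = poly (\<Sum>n<N. monom (a n) n)" by (simp add: S_def fun_eq_iff poly_sum poly_monom)
  moreover have "degree (\<Sum>n<N. monom (a n) n) < M"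
  proof -
    have "degree (\<Sum>n<N. monom (a n) n) \<le> N"
      by (rule degree_sum_le) (auto intro: order_trans[OF degree_monom_le])
    then show ?thesis using m by (simp add: M_def)
  qed
  ultimately have "\<forall>x. (deriv ^^ M) (S N) x = 0" using higher_deriv_poly_eq_0 by metis
  then have taylor: "S N x = (\<Sum>j<M. d j * (x - y) ^ j)" for x
    unfolding d_def by (rule entire_eq_taylor_polynomial[OF Sh])
  define h where "h x = (\<Sum>j<N. d (j + m) * (x - y) ^ j)" for x
  have h: "h \<in> exp_type"
    unfolding h_def by (intro exp_type_intros)
  define R where "R x = (\<Sum>j<m. d j * (x - y) ^ j)" for x
  have R: "R \<in> exp_type"
    unfolding R_def by (intro exp_type_intros)
  have split: "S N x = R x + (x - y) ^ m * h x" for x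
  proof -
    have "S N x = R x + (\<Sum>j=m..<M. d j * (x - y) ^ j)"
      unfolding taylor R_def lessThan_atLeast0 by (rule sum.atLeastLessThan_concat[symmetric]) (auto simp: M_def)
    also have "(\<Sum>j=m..<M. d j * (x - y) ^ j) = (\<Sum>j<N. d (j + m) * (x - y) ^ (j + m))"
      using sum.shift_bounds_nat_ivl[of "\<lambda>j. d j * (x - y) ^ j" 0 m N]
      by (simp add: M_def lessThan_atLeast0)
    also have "\<dots> = (x - y) ^ m * h x"
      by (simp add: h_def sum_distrib_left power_add mult_ac)
    finally show ?thesis .
  qed
  define \<delta> where "\<delta> = fock_norm (f - S N)"
  have \<delta>0: "\<delta> \<ge> 0" by (simp add: \<delta>_def fock_norm_nonneg)
  have fS: "f - S N \<in> fock_space" by (intro fock_space_diff ff exp_type_imp_fock S)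
  have d: "norm (d j) \<le> K j / fact j * \<delta>" if "j < m" for j
  proof -
    have "(deriv ^^ j) (f - S N) y = - (deriv ^^ j) (S N) y"
      using higher_deriv_diff[OF fh Sh, of y j] fz[OF that] by (simp add: fun_diff_def)
    then have "norm ((deriv ^^ j) (S N) y) \<le> K j * \<delta>"
      using K(2)[OF fS, of j] by (simp add: \<delta>_def)
    then show ?thesis by (simp add: d_def norm_divide divide_right_mono)
  qed
  have "fock_norm R \<le> (\<Sum>j<m. fock_norm (\<lambda>x. d j * (x - y) ^ j))"
    unfolding R_def
    by (rule fock_norm_sum_le) (auto intro!: exp_type_intros)
  also have "\<dots> \<le> (\<Sum>j<m. (K j / fact j * \<delta>) * fock_norm (\<lambda>x. (x - y) ^ j))"
    unfolding fock_norm_cmult by (intro sum_mono mult_right_mono d) (auto simp: fock_norm_nonneg)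
  also have "\<dots> = (L - 1) * \<delta>"
    by (simp add: L_def sum_distrib_left mult_ac)
  finally have R_le: "fock_norm R \<le> (L - 1) * \<delta>" .
  have eq: "f - (\<lambda>x. (x - y) ^ m * h x) = (f - S N) + R"
    by (simp add: fun_eq_iff split)
  have "fock_norm ((f - S N) + R) \<le> fock_norm (f - S N) + fock_norm R"
  proof (rule fock_norm_triangle[OF fS exp_type_imp_fock[OF R]])
    have "(\<lambda>x. (x - y) ^ m * h x) \<in> exp_type"
      by (intro exp_type_intros h)
    then show "(f - S N) + R \<in> fock_space"
      unfolding eq[symmetric] by (intro fock_space_diff ff exp_type_imp_fock)
  qed
  also have "\<dots> \<le> \<delta> + (L - 1) * \<delta>" using R_le by (simp add: \<delta>_def)
  also have "\<dots> = L * \<delta>" by (simp add: algebra_simps)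
  also have "\<dots> < \<epsilon>" using N L by (simp add: \<delta>_def field_simps)
  finally have "fock_dist f (\<lambda>x. (x - y) ^ m * h x) < \<epsilon>" by (simp only: fock_dist_def eq)
  with h show ?thesis using that by blast
qed

text \<open>
Elements of the domain vanish to order \<open>m\<close> at \<open>y\<close>, a condition that survives limits because the derivatives
at \<open>y\<close> are bounded functionals. The other inclusion is the preceding approximation, since the
approximants lie in the domain.
\<close>

lemma fock_closure_smax_dom:
  fixes a b A B C D :: complex
  assumes m: "m \<ge> 1" and nz: "a \<noteq> 0" "A \<noteq> 0" "C \<noteq> 0"
  defines "\<D> \<equiv> smax_dom m (\<lambda>x. C * exp (D * x)) (\<lambda>x. A * x + B) (\<lambda>x. (a * A * x + a * B + b) ^ m)"
  shows "fock_topology closure_of \<D> = fock_zeros m (- b / a)"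
proof -
  interpret Metric_space fock_space fock_dist by (rule Metric_space_fock)
  define y where "y = - b / a"
  have dom_fock: "g \<in> fock_space" if "g \<in> \<D>" for g
    using that by (auto simp: \<D>_def smax_dom_def)
  have dom_zero: "(deriv ^^ j) g y = 0" if g: "g \<in> \<D>" and j: "j < m" for g j
  proof -
    obtain H where H: "H holomorphic_on UNIV" "\<forall>w. g w = (w - (- b / a)) ^ m * H w"
      using g nz unfolding \<D>_def by (rule smax_dom_imp_factor)
    then have eq: "g = (\<lambda>w. (w - y) ^ m * H w)" by (auto simp: y_def)
    show ?thesis unfolding eq by (rule higher_deriv_eq_0_if_multiple_zero[OF H(1) j])
  qed
  have "f \<in> fock_topology closure_of \<D> \<longleftrightarrow> f \<in> fock_zeros m y" for f
  proof
    assume "f \<in> fock_topology closure_of \<D>"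
    then have f: "f \<in> fock_space" and cl: "\<And>r. r > 0 \<Longrightarrow> \<exists>g\<in>\<D>. fock_dist f g < r"
      by (auto simp: fock_topology_def metric_closure_of)
    have "(deriv ^^ j) f y = 0" if j: "j < m" for j
    proof -
      obtain K where K: "K \<ge> 0" "\<And>g. g \<in> fock_space \<Longrightarrow> norm ((deriv ^^ j) g y) \<le> K * fock_norm g"
        using fock_higher_deriv_bounded[of j y] by blast
      have "norm ((deriv ^^ j) f y) \<le> 0 + e" if "e > 0" for e
      proof -
        \<comment> \<open>\<open>K + 1\<close> instead of \<open>K\<close> keeps the divisor positive when \<open>K = 0\<close>.\<close>
        obtain g where g: "g \<in> \<D>" "fock_dist f g < e / (K + 1)"
          using cl[of "e / (K + 1)"] K \<open>e > 0\<close> by auto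
        have hol: "f holomorphic_on UNIV" "g holomorphic_on UNIV"
          using f dom_fock[OF g(1)] by (auto simp: fock_space_def)
        have "(deriv ^^ j) (f - g) y = (deriv ^^ j) f y"
          using higher_deriv_diff[OF hol, of y j] dom_zero[OF g(1) j] by (simp add: fun_diff_def)
        then have "norm ((deriv ^^ j) f y) \<le> K * fock_norm (f - g)"
          using K(2)[OF fock_space_diff[OF f dom_fock[OF g(1)]]] by simp
        also have "\<dots> \<le> (K + 1) * fock_norm (f - g)"
          by (intro mult_right_mono) (auto simp: fock_norm_nonneg)
        also have "\<dots> \<le> e" using g(2) K(1) by (simp add: fock_dist_def field_simps)
        finally show ?thesis by simp
      qed
      then have "norm ((deriv ^^ j) f y) \<le> 0" by (rule field_le_epsilon)
      then show ?thesis by simp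
    qed
    with f show "f \<in> fock_zeros m y" by (simp add: fock_zeros_def)
  next
    assume f: "f \<in> fock_zeros m y"
    have ff: "f \<in> fock_space" using f by (simp add: fock_zeros_def)
    have "\<exists>g\<in>\<D>. g \<in> mball f r" if "r > 0" for r
    proof -
      obtain h where h: "h \<in> exp_type" "fock_dist f (\<lambda>x. (x - y) ^ m * h x) < r"
        using fock_zeros_approximation[OF m f \<open>r > 0\<close>] by blast
      have "(\<lambda>x. (x - y) ^ m * h x) \<in> \<D>"
        unfolding \<D>_def
      proof (rule smax_dom_of_factor)
        show "(\<lambda>x. 1 / a ^ m * h x) \<in> exp_type" by (intro exp_type_intros h)
        fix x
        have "a * x + b = a * (x - y)" using nz by (simp add: y_def field_simps)
        then show "(x - y) ^ m * h x = (a * x + b) ^ m * (1 / a ^ m * h x)"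
          using nz by (simp add: power_mult_distrib)
      qed
      with h(2) ff dom_fock show ?thesis by (auto simp: in_mball)
    qed
    with ff show "f \<in> fock_topology closure_of \<D>"
      by (auto simp: fock_topology_def metric_closure_of)
  qed
  then show ?thesis by (auto simp: y_def)
qed

theorem proposition3p5:
  fixes m :: nat and a b A B C D :: complex
    and \<phi> \<psi> \<Phi> :: "complex \<Rightarrow> complex" and z :: complex
  assumes "m \<ge> 1" and "a \<noteq> 0" and "A \<noteq> 0" and "C \<noteq> 0"
    and "\<phi> = (\<lambda>x. A * x + B)"
    and "\<psi> = (\<lambda>x. C * exp (D * x))"
    and "\<Phi> = (\<lambda>x. (a * A * x + a * B + b) ^ m)"
  shows
    "(\<forall>f \<in> smax_dom m \<psi> \<phi> \<Phi>. \<forall>j<m. (deriv ^^ j) f (- b / a) = 0) \<and>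
     (\<forall>k<m. kern_k k z a b \<notin> smax_dom m \<psi> \<phi> \<Phi>) \<and>
     (\<forall>k\<ge>m. kern_k k z a b \<in> smax_dom m \<psi> \<phi> \<Phi> \<and>
        smax m \<psi> \<phi> \<Phi> (kern_k k z a b) =
          {\<theta>. \<theta> holomorphic_on UNIV \<and>
             (\<forall>x. (deriv ^^ m) \<theta> x =
                C * exp (B * cnj z) * (a * A * x + a * B + b) ^ (k - m) *
                kern (cnj A * z + cnj D) x)} \<and>
        affine_of_dim m (smax m \<psi> \<phi> \<Phi> (kern_k k z a b))) \<and>
     smax m \<psi> \<phi> \<Phi> (kern_k m z a b) =
       {\<theta>. \<exists>l \<in> poly_funs (m - 1). \<forall>x. \<theta> x =
          (if cnj A * z + cnj D = 0
           then 1 / fact m * C * exp (B * cnj z) * x ^ m + l x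
           else C * exp (B * cnj z) / (A * cnj z + D) ^ m *
                kern (cnj A * z + cnj D) x + l x)} \<and>
     fock_topology closure_of (smax_dom m \<psi> \<phi> \<Phi>) = fock_zeros m (- b / a)"
proof (intro conjI allI impI ballI)
  fix f j assume f: "f \<in> smax_dom m \<psi> \<phi> \<Phi>" and j: "j < m"
  obtain H where H: "H holomorphic_on UNIV" "\<forall>w. f w = (w - (- b / a)) ^ m * H w"
    using f assms(2-4) unfolding assms(5-7) by (rule smax_dom_imp_factor)
  then have eq: "f = (\<lambda>w. (w - (- b / a)) ^ m * H w)" by auto
  show "(deriv ^^ j) f (- b / a) = 0"
    unfolding eq by (rule higher_deriv_eq_0_if_multiple_zero[OF H(1) j])
next
  fix k assume "k < m"
  then show "kern_k k z a b \<notin> smax_dom m \<psi> \<phi> \<Phi>"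
    unfolding assms(5-7) using assms(2-4) by (rule kern_k_notin_smax_dom)
next
  fix k assume k: "m \<le> k"
  show "kern_k k z a b \<in> smax_dom m \<psi> \<phi> \<Phi>"
    unfolding assms(5-7) using k by (rule kern_k_mem_smax_dom)
  show eq: "smax m \<psi> \<phi> \<Phi> (kern_k k z a b) =
      {\<theta>. \<theta> holomorphic_on UNIV \<and> (\<forall>x. (deriv ^^ m) \<theta> x =
        C * exp (B * cnj z) * (a * A * x + a * B + b) ^ (k - m) * kern (cnj A * z + cnj D) x)}"
    unfolding assms(5-7) using k assms(2-4) by (rule smax_kern_k)
  show "affine_of_dim m (smax m \<psi> \<phi> \<Phi> (kern_k k z a b))"
    unfolding eq kern_def
    by (intro affine_of_dim_iterated_antiderivatives assms(1) holomorphic_intros)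
next
  define w where "w = A * cnj z + D"
  have w0: "cnj A * z + cnj D = 0 \<longleftrightarrow> w = 0"
    by (metis w_def complex_cnj_add complex_cnj_cnj complex_cnj_mult complex_cnj_zero)
  have kern: "kern (cnj A * z + cnj D) x = exp (w * x)" for x
    by (simp add: kern_def w_def mult.commute)
  define c where "c = C * exp (B * cnj z)"
  \<comment> \<open>One explicit solution; the others differ from it by a polynomial.\<close>
  define \<theta>\<^sub>0 where "\<theta>\<^sub>0 = (\<lambda>x. if w = 0 then 1 / fact m * c * x ^ m else c / w ^ m * exp (w * x))"
  have hol: "\<theta>\<^sub>0 holomorphic_on UNIV"
    unfolding \<theta>\<^sub>0_def by (cases "w = 0") (auto intro!: holomorphic_intros)
  have der: "\<forall>x. (deriv ^^ m) \<theta>\<^sub>0 x = c * (a * A * x + a * B + b) ^ (m - m) * kern (cnj A * z + cnj D) x"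
  proof (cases "w = 0")
    case True
    then have "\<theta>\<^sub>0 = (\<lambda>x. (1 / fact m * c) * x ^ m)" by (simp add: \<theta>\<^sub>0_def)
    then show ?thesis using True by (simp only: higher_deriv_power_self) (simp add: kern)
  next
    case False
    then have "\<theta>\<^sub>0 = (\<lambda>x. (c / w ^ m) * exp (w * x))" by (simp add: \<theta>\<^sub>0_def)
    then show ?thesis using False by (simp only: higher_deriv_exp_linear) (simp add: kern)
  qed
  have "smax m \<psi> \<phi> \<Phi> (kern_k m z a b) = {\<theta>. \<theta> holomorphic_on UNIV \<and> (\<forall>x. (deriv ^^ m) \<theta> x =
        c * (a * A * x + a * B + b) ^ (m - m) * kern (cnj A * z + cnj D) x)}"
    unfolding assms(5-7) c_def using order_refl assms(2-4) by (rule smax_kern_k)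
  also have "\<dots> = (\<lambda>l. \<theta>\<^sub>0 + l) ` poly_funs (m - 1)"
    by (rule iterated_antiderivatives_eq[OF assms(1) hol der])
  also have "\<dots> = {\<theta>. \<exists>l \<in> poly_funs (m - 1). \<forall>x. \<theta> x = \<theta>\<^sub>0 x + l x}"
    by (auto simp: fun_eq_iff)
  finally show "smax m \<psi> \<phi> \<Phi> (kern_k m z a b) =
       {\<theta>. \<exists>l \<in> poly_funs (m - 1). \<forall>x. \<theta> x =
          (if cnj A * z + cnj D = 0
           then 1 / fact m * C * exp (B * cnj z) * x ^ m + l x
           else C * exp (B * cnj z) / (A * cnj z + D) ^ m *
                kern (cnj A * z + cnj D) x + l x)}"
    unfolding w0 kern w_def[symmetric] \<theta>\<^sub>0_def c_def by (cases "w = 0") (simp_all add: mult.assoc)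
next
  show "fock_topology closure_of (smax_dom m \<psi> \<phi> \<Phi>) = fock_zeros m (- b / a)"
    unfolding assms(5-7) using assms(1-4) by (rule fock_closure_smax_dom)
qed

end
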